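(* Let $G$ be a finite plane graph with $N$ nodes, and let $K(G)$ be its associated alternating link diagram. Let $\hbar>0$ and let $(Q,t)$ be one of $$(Q,t)=(2,\hbar\pi/2),\qquad (3,2\hbar\pi/3),\qquad (4,\hbar\pi).$$ Put $q=(1-e^{it/\hbar})/\sqrt{Q}$. Then $$A_G(Q,t)=Q^{N/2}\sum_{j} q^{j}\,\chi\big(H^{\bullet\, j}(K(G))\big),$$ where $A_G(Q,t)=\sum_\sigma e^{(it/\hbar)E(\sigma)}$ is the quantum Potts amplitude and $H^{\bullet\, j}(K(G))$ denotes the Khovanov homology of the diagram $K(G)$ in quantum grading $j$.
   Context: Potts amplitude: in $A_G(Q,t)=\sum_\sigma e^{(it/\hbar)E(\sigma)}$, $\sigma$ runs over all assignments of an element of $\{1,\dots,Q\}$ to each node of $G$, and $E(\sigma)$ is the number of edges of $G$ whose end-nodes receive the same assignment. Smoothings: each crossing of a link diagram $D$ has an $A$-smoothing and a $B$-smoothing (the $A$-smoothing joins the two local regions swept out by turning the overcrossing strand counterclockwise; the $B$-smoothing joins the other two). Link diagram $K(G)$: place a crossing on each edge of $G$ and connect these crossings around each face of $G$ (the medial graph), shading in checkerboard fashion the regions containing nodes of $G$. Crossing information is chosen so that at each crossing the $B$-smoothing joins the shaded regions at the two ends of the edge (contraction of the edge), while the $A$-smoothing separates them (deletion of the edge); the result is an alternating diagram. Thus, for a spanning subgraph $H$ of $G$, taking $B$-smoothings exactly at the edges of $H$ gives the boundary curves of a planar regular neighbourhood of $H$. Khovanov complex (unnormalized, mod 2): an enhanced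 state $s$ of $D$ is a choice of smoothing at each crossing together with a label $1$ or $X$ on each resulting loop. Let $n_B(s)$ be the number of $B$-smoothings, $\lambda(s)$ the number of loops labeled $1$ minus the number labeled $X$, and $j(s)=n_B(s)+\lambda(s)$. Let $\mathcal{C}^{ij}$ be the $\mathbb{Z}/2\mathbb{Z}$-vector space with basis the enhanced states with $n_B(s)=i$ and $j(s)=j$. The differential $\partial:\mathcal{C}^{ij}\to\mathcal{C}^{i+1\,j}$ is $\partial(s)=\sum_\tau\partial_\tau(s)$, over sites $\tau$ with an $A$-smoothing in $s$, where $\partial_\tau(s)$ changes the smoothing at $\tau$ to a $B$-smoothing and relabels affected loops: merging loops by the product of $(\mathbb{Z}/2\mathbb{Z})[X]/(X^2)$, splitting loops by $\Delta(1)=1\otimes X+X\otimes 1$, $\Delta(X)=X\otimes X$. $H^{\bullet\, j}(D)$ is the homology of $\mathcal{C}^{\bullet\, j}$ and $\chi(H^{\bullet\, j})=\sum_i(-1)^i\dim H^{ij}$. *)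

theory Defs
  imports
    Complex_Main
    "HOL-Library.FuncSet"
    "HOL-Library.Groups_Big_Fun"
    "HOL-Library.Z2"
    "HOL-Combinatorics.Orbits"
    "HOL-Algebra.AbelCoset"
    "HOL-Algebra.Module"
    "Jordan_Normal_Form.VS_Connect"
begin

section \<open>Plane graphs\<close>

text \<open>
  A finite plane graph (loops, parallel edges, isolated nodes and several components are allowed)
  is given by its rotation system. Every edge \<open>e\<close> consists of two darts \<open>(e, True)\<close> and
  \<open>(e, False)\<close>, one leaving each end-node; which end is called \<open>True\<close> is immaterial. \<open>base\<close> maps
  a dart to the node it leaves, and \<open>rot\<close> maps a dart to the counterclockwise next dart around
  the same node.
\<close>

record ('v, 'e) embedded_graph =
  nodes :: "'v set"
  edges :: "'e set"
  base :: "'e \<times> bool \<Rightarrow> 'v"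
  rot :: "'e \<times> bool \<Rightarrow> 'e \<times> bool"

definition flip :: "'e \<times> bool \<Rightarrow> 'e \<times> bool" where
  "flip d = (fst d, \<not> snd d)"

definition darts :: "('v, 'e) embedded_graph \<Rightarrow> ('e \<times> bool) set" where
  "darts G = edges G \<times> UNIV"

definition isolated_nodes :: "('v, 'e) embedded_graph \<Rightarrow> 'v set" where
  "isolated_nodes G = nodes G - base G ` darts G"

definition components :: "('v, 'e) embedded_graph \<Rightarrow> 'v set set" where
  "components G = nodes G // {(base G d, base G (flip d)) | d. d \<in> darts G}\<^sup>*"

text \<open>
  A dart \<open>d\<close> is followed, along the boundary walk of the face on its right, by
  \<open>rot G (flip d)\<close>.
\<close>

definition face_walks :: "('v, 'e) embedded_graph \<Rightarrow> ('e \<times> bool) set set" where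
  "face_walks G = {orbit (rot G \<circ> flip) d | d. d \<in> darts G}"

text \<open>
  The last condition says that every component is embedded in the sphere: it is Euler's formula
  \<open>V - E + F = 2\<close> summed over the components. Boundary walks are counted component by component,
  and an isolated node contributes one boundary walk that contains no dart. How the components
  of a disconnected plane graph are nested in each other's faces is not recorded; it affects
  neither the crossings nor the smoothings of the diagram below.
\<close>

definition plane_graph :: "('v, 'e) embedded_graph \<Rightarrow> bool" where
  "plane_graph G \<longleftrightarrow>
     finite (nodes G) \<and> finite (edges G) \<and>
     base G \<in> darts G \<rightarrow> nodes G \<and>
     rot G permutes darts G \<and>
     (\<forall>d\<in>darts G. orbit (rot G) d = {d'\<in>darts G. base G d' = base G d}) \<and>
     card (nodes G) + (card (face_walks G) + card (isolated_nodes G))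
       = card (edges G) + 2 * card (components G)"


section \<open>The Potts amplitude\<close>

definition energy :: "('v, 'e) embedded_graph \<Rightarrow> ('v \<Rightarrow> nat) \<Rightarrow> nat" where
  "energy G \<sigma> = card {e\<in>edges G. \<sigma> (base G (e, True)) = \<sigma> (base G (e, False))}"

definition potts_amplitude :: "('v, 'e) embedded_graph \<Rightarrow> real \<Rightarrow> nat \<Rightarrow> real \<Rightarrow> complex" where
  "potts_amplitude G hbar Q t =
     (\<Sum>\<sigma> \<in> nodes G \<rightarrow>\<^sub>E {1..Q}. exp (\<i> * complex_of_real (t / hbar) * of_nat (energy G \<sigma>)))"


section \<open>Link diagrams and smoothings\<close>

text \<open>
  A link diagram is given by a planar diagram code: \<open>pd D c = (x\<^sub>0, x\<^sub>1, x\<^sub>2, x\<^sub>3)\<close> lists the arcs of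
  the diagram met at the crossing \<open>c\<close> in counterclockwise order, starting at an end of the
  undercrossing strand. So \<open>x\<^sub>0, x\<^sub>2\<close> belong to the undercrossing strand and \<open>x\<^sub>1, x\<^sub>3\<close> to the
  overcrossing strand. \<open>circles D\<close> are the components that pass through no crossing.
\<close>

record ('c, 'a) link_diagram =
  crossings :: "'c set"
  pd :: "'c \<Rightarrow> 'a \<times> 'a \<times> 'a \<times> 'a"
  circles :: "'a set"

definition arcs_at :: "('c, 'a) link_diagram \<Rightarrow> 'c \<Rightarrow> 'a set" where
  "arcs_at D c = (case pd D c of (x0, x1, x2, x3) \<Rightarrow> {x0, x1, x2, x3})"

definition diagram_arcs :: "('c, 'a) link_diagram \<Rightarrow> 'a set" where
  "diagram_arcs D = (\<Union>c\<in>crossings D. arcs_at D c) \<union> circles D"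

text \<open>
  Turning the overcrossing strand \<open>x\<^sub>1 x\<^sub>3\<close> counterclockwise sweeps out the region between
  \<open>x\<^sub>1\<close> and \<open>x\<^sub>2\<close> and the region between \<open>x\<^sub>3\<close> and \<open>x\<^sub>0\<close>. Joining these two regions
  (the A-smoothing) connects \<open>x\<^sub>0\<close> with \<open>x\<^sub>1\<close> and \<open>x\<^sub>2\<close> with \<open>x\<^sub>3\<close>.
\<close>

definition A_joins :: "('c, 'a) link_diagram \<Rightarrow> 'c \<Rightarrow> ('a \<times> 'a) set" where
  "A_joins D c = (case pd D c of (x0, x1, x2, x3) \<Rightarrow> {(x0, x1), (x2, x3)})"

definition B_joins :: "('c, 'a) link_diagram \<Rightarrow> 'c \<Rightarrow> ('a \<times> 'a) set" where
  "B_joins D c = (case pd D c of (x0, x1, x2, x3) \<Rightarrow> {(x1, x2), (x3, x0)})"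

text \<open>
  A choice of smoothings is the set \<open>S\<close> of crossings that receive the B-smoothing. A loop of the
  smoothed diagram is represented by the set of arcs it runs through.
\<close>

definition same_loop :: "('c, 'a) link_diagram \<Rightarrow> 'c set \<Rightarrow> ('a \<times> 'a) set" where
  "same_loop D S =
     (let R = (\<Union>c\<in>crossings D. if c \<in> S then B_joins D c else A_joins D c) in (R \<union> R\<inverse>)\<^sup>*)"

definition loops :: "('c, 'a) link_diagram \<Rightarrow> 'c set \<Rightarrow> 'a set set" where
  "loops D S = diagram_arcs D // same_loop D S"

definition loop_of :: "('c, 'a) link_diagram \<Rightarrow> 'c set \<Rightarrow> 'a \<Rightarrow> 'a set" where
  "loop_of D S x = same_loop D S `` {x}"


section \<open>The diagram associated with a plane graph\<close>

text \<open>
  The medial graph has one vertex on each edge of \<open>G\<close> and one arc through each corner of a face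
  of \<open>G\<close>. The arc \<open>Inl d\<close> runs through the corner immediately clockwise of the dart \<open>d\<close>, and so
  joins the crossing on the edge of \<open>d\<close> to the crossing on the edge of the clockwise next dart.
  Draw the edge \<open>e\<close> horizontally with \<open>d = (e, True)\<close> leaving its left end. Then the four arcs
  at \<open>e\<close>, counterclockwise from the upper left one, are
  \<open>rot G d\<close>, \<open>d\<close>, \<open>rot G (flip d)\<close>, \<open>flip d\<close>.
  The shaded regions are the left and the right one. The B-smoothing, which connects \<open>d\<close> with
  \<open>rot G (flip d)\<close> and \<open>flip d\<close> with \<open>rot G d\<close>, is the one that joins them. Starting
  from the dart \<open>(e, False)\<close> instead would turn the code by two places, which is the same
  crossing. The boundary of a neighbourhood of an isolated node is a circle without crossings.
\<close>

definition medial_diagram ::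
  "('v, 'e) embedded_graph \<Rightarrow> ('e, ('e \<times> bool) + 'v) link_diagram" where
  "medial_diagram G = \<lparr>
     crossings = edges G,
     pd = (\<lambda>e. (Inl (rot G (e, True)), Inl (e, True), Inl (rot G (e, False)), Inl (e, False))),
     circles = Inr ` isolated_nodes G \<rparr>"


section \<open>The Khovanov complex modulo 2\<close>

datatype label = Lab1 | LabX

type_synonym ('c, 'a) enhanced_state = "'c set \<times> ('a set \<Rightarrow> label)"

definition enhanced_states :: "('c, 'a) link_diagram \<Rightarrow> ('c, 'a) enhanced_state set" where
  "enhanced_states D = (SIGMA S : Pow (crossings D). loops D S \<rightarrow>\<^sub>E UNIV)"

definition n_B :: "('c, 'a) enhanced_state \<Rightarrow> int" where
  "n_B s = int (card (fst s))"

definition label_excess :: "('c, 'a) link_diagram \<Rightarrow> ('c, 'a) enhanced_state \<Rightarrow> int" where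
  "label_excess D s =
     int (card {\<gamma>\<in>loops D (fst s). snd s \<gamma> = Lab1}) - int (card {\<gamma>\<in>loops D (fst s). snd s \<gamma> = LabX})"

definition q_grading :: "('c, 'a) link_diagram \<Rightarrow> ('c, 'a) enhanced_state \<Rightarrow> int" where
  "q_grading D s = n_B s + label_excess D s"

text \<open>
  The multiplication and the comultiplication of \<open>(Z/2)[X]/(X\<^sup>2)\<close> on the basis \<open>1, X\<close>: the set of
  basis elements (pairs of basis elements, for \<open>1 \<otimes> X\<close> etc.) occurring in the result, all
  coefficients being 0 or 1.
\<close>

fun label_mult :: "label \<Rightarrow> label \<Rightarrow> label set" where
  "label_mult Lab1 y = {y}"
| "label_mult LabX Lab1 = {LabX}"
| "label_mult LabX LabX = {}"

fun label_comult :: "label \<Rightarrow> (label \<times> label) set" where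
  "label_comult Lab1 = {(Lab1, LabX), (LabX, Lab1)}"
| "label_comult LabX = {(LabX, LabX)}"

text \<open>
  The enhanced states occurring in \<open>\<partial>\<^sub>\<tau>(s)\<close>, where \<open>s = (S, l)\<close> has an A-smoothing at \<open>\<tau>\<close>. The loops
  at \<open>\<tau>\<close> are those of \<open>x\<^sub>0\<close> and \<open>x\<^sub>2\<close> in \<open>s\<close>, and those of \<open>x\<^sub>0\<close> and \<open>x\<^sub>2\<close> after the
  change of smoothing. If the former two differ they are merged, otherwise their common loop
  is split.
\<close>

definition resmoothings ::
  "('c, 'a) link_diagram \<Rightarrow> 'c \<Rightarrow> ('c, 'a) enhanced_state \<Rightarrow> ('c, 'a) enhanced_state set" where
  "resmoothings D \<tau> s = (case (s, pd D \<tau>) of ((S, l), (x0, x1, x2, x3)) \<Rightarrow>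
     {(S', l') \<in> enhanced_states D.
        S' = insert \<tau> S \<and>
        (\<forall>\<gamma>\<in>loops D S. \<gamma> \<inter> arcs_at D \<tau> = {} \<longrightarrow> l' \<gamma> = l \<gamma>) \<and>
        (if loop_of D S x0 \<noteq> loop_of D S x2
         then l' (loop_of D S' x0) \<in> label_mult (l (loop_of D S x0)) (l (loop_of D S x2))
         else (l' (loop_of D S' x0), l' (loop_of D S' x2)) \<in> label_comult (l (loop_of D S x0)))})"

text \<open>
  Chains are written as coefficient functions on enhanced states, and \<open>differential\<close> is the linear
  extension of \<open>\<partial>(s) = \<Sum>\<^sub>\<tau> \<partial>\<^sub>\<tau>(s)\<close>. The ring operations \<open>mult\<close> and \<open>one\<close> of the module
  record are irrelevant for vector spaces.
\<close>

definition chain_space ::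
  "('c, 'a) link_diagram \<Rightarrow> int \<Rightarrow> int \<Rightarrow> (bit, ('c, 'a) enhanced_state \<Rightarrow> bit) module" where
  "chain_space D i j = \<lparr>
     carrier = {f. \<forall>s. f s \<noteq> 0 \<longrightarrow> s \<in> enhanced_states D \<and> n_B s = i \<and> q_grading D s = j},
     monoid.mult = undefined, one = undefined,
     zero = (\<lambda>s. 0), add = (\<lambda>f g s. f s + g s), smult = (\<lambda>c f s. c * f s) \<rparr>"

definition differential ::
  "('c, 'a) link_diagram \<Rightarrow> (('c, 'a) enhanced_state \<Rightarrow> bit) \<Rightarrow> ('c, 'a) enhanced_state \<Rightarrow> bit" where
  "differential D f = (\<lambda>s'. \<Sum>s\<in>enhanced_states D. f s *
     (\<Sum>\<tau>\<in>crossings D - fst s. of_bool (s' \<in> resmoothings D \<tau> s)))"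

definition quotient_module :: "('r, 'b) module \<Rightarrow> 'b set \<Rightarrow> ('r, 'b set) module" where
  "quotient_module M N = \<lparr>
     carrier = a_rcosets\<^bsub>M\<^esub> N,
     monoid.mult = undefined, one = undefined,
     zero = N, add = set_add M,
     smult = (\<lambda>c U. \<Union>u\<in>U. N +>\<^bsub>M\<^esub> (c \<odot>\<^bsub>M\<^esub> u)) \<rparr>"

definition homology ::
  "('c, 'a) link_diagram \<Rightarrow> int \<Rightarrow> int \<Rightarrow> (bit, (('c, 'a) enhanced_state \<Rightarrow> bit) set) module" where
  "homology D i j =
     quotient_module
       ((chain_space D i j)
          \<lparr>carrier := {f \<in> carrier (chain_space D i j). differential D f = (\<lambda>s. 0)}\<rparr>)
       (differential D ` carrier (chain_space D (i - 1) j))"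

text \<open>The chain spaces vanish unless \<open>0 \<le> i \<le> card (crossings D)\<close>.\<close>

definition euler_char :: "('c, 'a) link_diagram \<Rightarrow> int \<Rightarrow> int" where
  "euler_char D j =
     (\<Sum>i\<le>card (crossings D). (-1) ^ i * int (vectorspace.dim class_ring (homology D (int i) j)))"

end

theory Submission
  imports Defs
begin

text \<open>
  Both sides are sums over the sets \<open>S\<close> of edges. The amplitude is
  \<open>\<Sum>\<^sub>S v\<^bsup>|S|\<^esup> Q\<^bsup>k(S)\<^esup>\<close> with \<open>v = e\<^bsup>it/hbar\<^esup> - 1\<close>, where \<open>k(S)\<close> counts the components of the
  spanning subgraph \<open>S\<close> (\<open>fortuin_kasteleyn\<close>). An Euler characteristic may be computed from the
  chains (\<open>euler_char_eq\<close>), and summation over the labels of the states with B-smoothings at \<open>S\<close>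
  turns the other side into \<open>\<Sum>\<^sub>S (-q)\<^bsup>|S|\<^esup> (q + 1/q)\<^bsup>l(S)\<^esup>\<close>, where \<open>l(S)\<close> counts the loops
  (\<open>state_sum\<close>). For the three parameter values \<open>q + 1/q = sqrt Q\<close> and \<open>v = - q sqrt Q\<close>
  (\<open>potts_point_equation\<close>). So the terms agree as soon as \<open>l(S) + N = 2 k(S) + |S|\<close>
  (\<open>card_loops_eq\<close>), which is Euler's formula for the spanning subgraph \<open>S\<close>, the loops
  being the boundary curves of its neighbourhood.

  Euler's formula is given for \<open>G\<close> only. The number \<open>2 k(S) + |S| - N - l(S)\<close>, twice a genus, never
  decreases when an edge is added (\<open>defect_step\<close>). It is \<open>0\<close> for no edges and for all
  edges, hence always. The same argument shows that every change of smoothing changes the number of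
  loops, so that it merges two loops or splits one, as the Khovanov differential presupposes.

  The passage from homology to chains needs \<open>\<partial>\<partial> = 0\<close>. Rather than by the many configurations of
  two crossings, this is proved by embedding the chains of all smoothings into one commutative
  ring over \<open>Z/2\<close> with a generator of square \<open>0\<close> for each arc. There a split becomes the identity
  and a merger the multiplication by the sum of two generators (\<open>expansion_differential\<close>), so the
  faces of the cube commute almost for free (\<open>square_commutes\<close>).
\<close>

section \<open>Equivalence relations with two classes joined\<close>

definition join_rel :: "('a \<times> 'a) set \<Rightarrow> 'a \<Rightarrow> 'a \<Rightarrow> ('a \<times> 'a) set" where
  "join_rel E a b = E \<union> (E `` {a}) \<times> (E `` {b}) \<union> (E `` {b}) \<times> (E `` {a})"

lemma equiv_join_rel:
  assumes "equiv UNIV E"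
  shows "equiv UNIV (join_rel E a b)"
proof -
  have r: "(x, x) \<in> E" and s: "(x, y) \<in> E \<Longrightarrow> (y, x) \<in> E"
    and t: "(x, y) \<in> E \<Longrightarrow> (y, z) \<in> E \<Longrightarrow> (x, z) \<in> E" for x y z
    using assms by (auto simp: equiv_def refl_on_def dest: symD transD)
  show ?thesis
  proof (rule equivI)
    show "refl (join_rel E a b)" using r by (auto simp: refl_on_def join_rel_def)
    show "sym (join_rel E a b)" using s by (auto simp: sym_def join_rel_def)
    show "trans (join_rel E a b)"
      unfolding trans_def join_rel_def by simp (metis s t)
  qed auto
qed

lemma join_rel_pair: "equiv UNIV E \<Longrightarrow> (a, b) \<in> join_rel E a b"
  by (auto simp: join_rel_def equiv_def refl_on_def)

lemma join_rel_least:
  assumes "equiv UNIV F" "E \<subseteq> F" "(a, b) \<in> F"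
  shows "join_rel E a b \<subseteq> F"
proof -
  have s: "(x, y) \<in> F \<Longrightarrow> (y, x) \<in> F"
    and t: "(x, y) \<in> F \<Longrightarrow> (y, z) \<in> F \<Longrightarrow> (x, z) \<in> F" for x y z
    using assms(1) by (auto simp: equiv_def dest: symD transD)
  show ?thesis
  proof
    fix z assume "z \<in> join_rel E a b"
    then obtain x y where "z = (x, y)"
      "(x, y) \<in> F \<or> (a, x) \<in> F \<and> (b, y) \<in> F \<or> (b, x) \<in> F \<and> (a, y) \<in> F"
      using assms(2) by (cases z) (auto simp: join_rel_def)
    then show "z \<in> F" using assms(3) s t by metis
  qed
qed

lemma join_rel_absorb:
  assumes "equiv UNIV E" "(a, b) \<in> E"
  shows "join_rel E a b = E"
  using join_rel_least[OF assms(1) subset_refl assms(2)] by (auto simp: join_rel_def)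

lemma join_rel_Image:
  assumes "equiv UNIV E"
  shows "join_rel E a b `` {x} =
    (if (x, a) \<in> E \<or> (x, b) \<in> E then E `` {a} \<union> E `` {b} else E `` {x})"
proof -
  have r: "(x, x) \<in> E" and s: "(x, y) \<in> E \<Longrightarrow> (y, x) \<in> E"
    and t: "(x, y) \<in> E \<Longrightarrow> (y, z) \<in> E \<Longrightarrow> (x, z) \<in> E" for x y z
    using assms by (auto simp: equiv_def refl_on_def dest: symD transD)
  show ?thesis
  proof (rule Set.set_eqI)
    fix y
    have "y \<in> join_rel E a b `` {x} \<longleftrightarrow>
        (x, y) \<in> E \<or> (a, x) \<in> E \<and> (b, y) \<in> E \<or> (b, x) \<in> E \<and> (a, y) \<in> E"
      by (simp add: join_rel_def)
    also have "\<dots> \<longleftrightarrow> (if (x, a) \<in> E \<or> (x, b) \<in> E then (a, y) \<in> E \<or> (b, y) \<in> E else (x, y) \<in> E)"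
      using s[of x a] s[of a x] s[of x b] s[of b x]
        t[of x a y] t[of a x y] t[of x b y] t[of b x y] by argo
    finally show "y \<in> join_rel E a b `` {x} \<longleftrightarrow>
        y \<in> (if (x, a) \<in> E \<or> (x, b) \<in> E then E `` {a} \<union> E `` {b} else E `` {x})"
      by simp
  qed
qed

lemma quotient_join_rel:
  assumes "equiv UNIV E" "a \<in> A" "b \<in> A"
  shows "A // join_rel E a b = A // E - {E `` {a}, E `` {b}} \<union> {E `` {a} \<union> E `` {b}}"
proof -
  have r: "(x, x) \<in> E" and s: "(x, y) \<in> E \<Longrightarrow> (y, x) \<in> E" for x y
    using assms by (auto simp: equiv_def refl_on_def dest: symD transD)
  have eq: "E `` {x} = E `` {y} \<longleftrightarrow> (x, y) \<in> E" for x y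
    using assms(1) by (simp add: eq_equiv_class_iff)
  have "A // join_rel E a b = (\<lambda>x. join_rel E a b `` {x}) ` A"
    by (auto simp: quotient_def)
  also have "\<dots> = (\<lambda>x. E `` {x}) ` {x \<in> A. (x, a) \<notin> E \<and> (x, b) \<notin> E} \<union> {E `` {a} \<union> E `` {b}}"
    (is "?L = ?R")
  proof
    show "?L \<subseteq> ?R" unfolding join_rel_Image[OF assms(1)] by auto
    have "join_rel E a b `` {a} = E `` {a} \<union> E `` {b}"
      using r by (simp add: join_rel_Image[OF assms(1)])
    moreover have "join_rel E a b `` {x} = E `` {x}" if "(x, a) \<notin> E" "(x, b) \<notin> E" for x
      using that by (simp add: join_rel_Image[OF assms(1)])
    ultimately show "?R \<subseteq> ?L" using assms(2) by (auto intro!: image_eqI)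
  qed
  also have "(\<lambda>x. E `` {x}) ` {x \<in> A. (x, a) \<notin> E \<and> (x, b) \<notin> E} = A // E - {E `` {a}, E `` {b}}"
  proof -
    have "f ` {x \<in> A. f x \<noteq> p \<and> f x \<noteq> q} = f ` A - {p, q}" for f :: "'a \<Rightarrow> 'a set" and p q
      by auto
    from this[of "\<lambda>x. E `` {x}" "E `` {a}" "E `` {b}"] show ?thesis
      unfolding eq by (simp add: quotient_def UNION_singleton_eq_range)
  qed
  finally show ?thesis .
qed

lemma card_quotient_join_rel:
  assumes "equiv UNIV E" "finite A" "a \<in> A" "b \<in> A"
  shows "card (A // join_rel E a b) + of_bool ((a, b) \<notin> E) = card (A // E)"
proof (cases "(a, b) \<in> E")
  case True
  then show ?thesis using assms(1) by (simp add: join_rel_absorb)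
next
  case False
  have eq: "E `` {x} = E `` {y} \<longleftrightarrow> (x, y) \<in> E" for x y
    using assms(1) by (simp add: eq_equiv_class_iff)
  have r: "(x, x) \<in> E" and s: "(x, y) \<in> E \<Longrightarrow> (y, x) \<in> E"
    and t: "(x, y) \<in> E \<Longrightarrow> (y, z) \<in> E \<Longrightarrow> (x, z) \<in> E" for x y z
    using assms by (auto simp: equiv_def refl_on_def dest: symD transD)
  have fin: "finite (A // E)"
    using assms(2) by (auto simp: quotient_def)
  have in_q: "E `` {a} \<in> A // E" "E `` {b} \<in> A // E"
    using assms(3,4) by (auto intro: quotientI)
  have "E `` {a} \<union> E `` {b} \<notin> A // E"
  proof
    assume "E `` {a} \<union> E `` {b} \<in> A // E"
    then obtain x where x: "E `` {a} \<union> E `` {b} = E `` {x}" by (auto simp: quotient_def)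
    then have "(x, a) \<in> E" "(x, b) \<in> E" using r by blast+
    then show False using False s t by blast
  qed
  then have "card (A // join_rel E a b) = card (A // E - {E `` {a}, E `` {b}}) + 1"
    unfolding quotient_join_rel[OF assms(1,3,4)] using fin by simp
  moreover have "card {E `` {a}, E `` {b}} = 2" using False eq by auto
  then have "card (A // E - {E `` {a}, E `` {b}}) = card (A // E) - 2"
    using in_q fin by (subst card_Diff_subset) auto
  moreover have "card (A // E) \<ge> 2"
    using card_mono[OF fin, of "{E `` {a}, E `` {b}}"] in_q \<open>card {E `` {a}, E `` {b}} = 2\<close> by auto
  ultimately show ?thesis using False by simp
qed


section \<open>How the loops change at one crossing\<close>

text \<open>
  In either smoothing of a crossing the four arcs form two strands, and \<open>x\<^sub>0, x\<^sub>2\<close> lie on different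
  ones. So these two arcs decide whether the strands belong to one loop or to two.
\<close>

definition end0 :: "('c, 'a) link_diagram \<Rightarrow> 'c \<Rightarrow> 'a" where
  "end0 D \<tau> = (case pd D \<tau> of (x0, x1, x2, x3) \<Rightarrow> x0)"

definition end2 :: "('c, 'a) link_diagram \<Rightarrow> 'c \<Rightarrow> 'a" where
  "end2 D \<tau> = (case pd D \<tau> of (x0, x1, x2, x3) \<Rightarrow> x2)"

lemma arcs_at_subset: "\<tau> \<in> crossings D \<Longrightarrow> arcs_at D \<tau> \<subseteq> diagram_arcs D"
  unfolding diagram_arcs_def by blast

lemma ends_in_arcs:
  assumes "\<tau> \<in> crossings D"
  shows "end0 D \<tau> \<in> diagram_arcs D" "end2 D \<tau> \<in> diagram_arcs D"
proof -
  have "end0 D \<tau> \<in> arcs_at D \<tau>" "end2 D \<tau> \<in> arcs_at D \<tau>"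
    by (simp_all add: arcs_at_def end0_def end2_def split: prod.split)
  then show "end0 D \<tau> \<in> diagram_arcs D" "end2 D \<tau> \<in> diagram_arcs D"
    using arcs_at_subset[OF assms] by blast+
qed

lemma equiv_symmetric_rtrancl: "equiv UNIV ((R \<union> R\<inverse>)\<^sup>*)"
proof (rule equivI)
  show "sym ((R \<union> R\<inverse>)\<^sup>*)" by (rule sym_rtrancl[OF sym_Un_converse])
qed (rule refl_rtrancl trans_rtrancl subset_UNIV | simp)+

lemma equiv_same_loop: "equiv UNIV (same_loop D S)"
  by (simp add: same_loop_def Let_def equiv_symmetric_rtrancl)

lemma same_loop_refl [simp]: "(x, x) \<in> same_loop D S"
  using equiv_same_loop[of D S] by (simp add: equiv_def refl_on_def)

lemma same_loop_sym: "(x, y) \<in> same_loop D S \<Longrightarrow> (y, x) \<in> same_loop D S"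
  using equiv_same_loop[of D S] by (simp add: equiv_def symD)

lemma same_loop_trans:
  "(x, y) \<in> same_loop D S \<Longrightarrow> (y, z) \<in> same_loop D S \<Longrightarrow> (x, z) \<in> same_loop D S"
  using equiv_same_loop[of D S] unfolding equiv_def by (metis transD)

lemma same_loop_join:
  assumes "c \<in> crossings D" "(x, y) \<in> (if c \<in> S then B_joins D c else A_joins D c)"
  shows "(x, y) \<in> same_loop D S"
  unfolding same_loop_def Let_def using assms by (intro r_into_rtrancl) blast

lemma same_loop_least:
  assumes "equiv UNIV F"
    and "\<And>c. c \<in> crossings D \<Longrightarrow> (if c \<in> S then B_joins D c else A_joins D c) \<subseteq> F"
  shows "same_loop D S \<subseteq> F"
proof -
  let ?R = "\<Union>c\<in>crossings D. if c \<in> S then B_joins D c else A_joins D c"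
  have "?R \<subseteq> F" using assms(2) by blast
  then have "?R \<union> ?R\<inverse> \<subseteq> F"
    using assms(1) by (auto simp: equiv_def dest: symD)
  then have "(?R \<union> ?R\<inverse>)\<^sup>* \<subseteq> F\<^sup>*" by (rule rtrancl_mono)
  also have "F\<^sup>* = F"
  proof -
    have F: "trans F" "refl F" using assms(1) by (auto simp: equiv_def)
    have "(x, y) \<in> F" if "(x, y) \<in> F\<^sup>*" for x y
      using that
    proof induction
      case base
      show ?case using F(2) by (simp add: refl_on_def)
    next
      case (step y z)
      show ?case by (rule transD[OF F(1) step.IH step.hyps(2)])
    qed
    then show ?thesis by auto
  qed
  finally show ?thesis by (simp add: same_loop_def Let_def)
qed

lemma joins_at:
  assumes "pd D \<tau> = (x0, x1, x2, x3)" "\<tau> \<in> crossings D"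
  shows "\<tau> \<notin> S \<Longrightarrow> (x0, x1) \<in> same_loop D S" "\<tau> \<notin> S \<Longrightarrow> (x2, x3) \<in> same_loop D S"
    "\<tau> \<in> S \<Longrightarrow> (x1, x2) \<in> same_loop D S" "\<tau> \<in> S \<Longrightarrow> (x3, x0) \<in> same_loop D S"
  using assms by (auto intro!: same_loop_join[of \<tau>] simp: A_joins_def B_joins_def)

text \<open>
  Once \<open>x\<^sub>0\<close> and \<open>x\<^sub>2\<close> are joined, the A-smoothing and the B-smoothing both connect all four arcs at
  the crossing. The loops before and after a change of smoothing are therefore compared through
  this common coarsening, which joins at most two loops of either state.
\<close>

lemma join_same_loop_eq:
  assumes "\<tau> \<in> crossings D" "\<tau> \<notin> S"
  shows "join_rel (same_loop D (insert \<tau> S)) (end0 D \<tau>) (end2 D \<tau>)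
       = join_rel (same_loop D S) (end0 D \<tau>) (end2 D \<tau>)"
proof -
  obtain x0 x1 x2 x3 where pd: "pd D \<tau> = (x0, x1, x2, x3)" by (cases "pd D \<tau>") auto
  have ends: "end0 D \<tau> = x0" "end2 D \<tau> = x2" by (auto simp: end0_def end2_def pd)
  have sub: "join_rel (same_loop D T) x0 x2 \<subseteq> join_rel (same_loop D U) x0 x2"
    if TU: "T - {\<tau>} = U - {\<tau>}" for T U
  proof (rule join_rel_least)
    let ?J = "join_rel (same_loop D U) x0 x2"
    show J: "equiv UNIV ?J" by (rule equiv_join_rel[OF equiv_same_loop])
    show x02: "(x0, x2) \<in> ?J" by (rule join_rel_pair[OF equiv_same_loop])
    have s: "(x, y) \<in> ?J \<Longrightarrow> (y, x) \<in> ?J"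
      and t: "(x, y) \<in> ?J \<Longrightarrow> (y, z) \<in> ?J \<Longrightarrow> (x, z) \<in> ?J" for x y z
      using J by (auto simp: equiv_def dest: symD transD)
    have incl: "same_loop D U \<subseteq> ?J" by (auto simp: join_rel_def)
    show "same_loop D T \<subseteq> ?J"
    proof (rule same_loop_least[OF J])
      fix c assume c: "c \<in> crossings D"
      show "(if c \<in> T then B_joins D c else A_joins D c) \<subseteq> ?J"
      proof (cases "c = \<tau>")
        case False
        then have "c \<in> T \<longleftrightarrow> c \<in> U" using TU by blast
        then have "(if c \<in> T then B_joins D c else A_joins D c) \<subseteq> same_loop D U"
          using same_loop_join[OF c, of _ _ U] by (auto split: if_splits)
        then show ?thesis using incl by simp
      next
        case True
        have "(x0, x1) \<in> ?J \<and> (x2, x3) \<in> ?J \<and> (x1, x2) \<in> ?J \<and> (x3, x0) \<in> ?J"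
        proof (cases "\<tau> \<in> U")
          case True
          then have "(x1, x2) \<in> ?J" "(x3, x0) \<in> ?J"
            using joins_at(3,4)[OF pd assms(1) True] incl by auto
          then show ?thesis using x02 by (metis s t)
        next
          case False
          then have "(x0, x1) \<in> ?J" "(x2, x3) \<in> ?J"
            using joins_at(1,2)[OF pd assms(1) False] incl by auto
          then show ?thesis using x02 by (metis s t)
        qed
        then show ?thesis using True pd by (auto simp: A_joins_def B_joins_def)
      qed
    qed
  qed
  show ?thesis unfolding ends using sub[of S "insert \<tau> S"] sub[of "insert \<tau> S" S] by simp
qed

lemma same_loop_closed:
  assumes "(x, y) \<in> same_loop D S" "x \<in> diagram_arcs D"
  shows "y \<in> diagram_arcs D"
proof -
  let ?F = "{(x, y). x \<in> diagram_arcs D \<longleftrightarrow> y \<in> diagram_arcs D}"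
  have "same_loop D S \<subseteq> ?F"
  proof (rule same_loop_least)
    show "equiv UNIV ?F" by (rule equivI) (auto simp: refl_on_def sym_def trans_def)
    fix c assume c: "c \<in> crossings D"
    obtain x0 x1 x2 x3 where pd: "pd D c = (x0, x1, x2, x3)" by (cases "pd D c") auto
    have "x0 \<in> diagram_arcs D \<and> x1 \<in> diagram_arcs D \<and> x2 \<in> diagram_arcs D \<and> x3 \<in> diagram_arcs D"
      using arcs_at_subset[OF c] by (simp add: arcs_at_def pd)
    then show "(if c \<in> S then B_joins D c else A_joins D c) \<subseteq> ?F"
      by (simp add: pd A_joins_def B_joins_def)
  qed
  then have "(x, y) \<in> ?F" using assms(1) by (rule subsetD)
  then show ?thesis using assms(2) by simp
qed

lemma loop_of_eq_iff: "loop_of D S x = loop_of D S y \<longleftrightarrow> (x, y) \<in> same_loop D S"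
  by (simp add: loop_of_def eq_equiv_class_iff[OF equiv_same_loop])

lemma mem_loop_of: "y \<in> loop_of D S x \<longleftrightarrow> (x, y) \<in> same_loop D S"
  by (simp add: loop_of_def)

lemma loops_eq_image: "loops D S = loop_of D S ` diagram_arcs D"
  by (auto simp: loops_def quotient_def loop_of_def)

lemma loop_of_in_loops: "x \<in> diagram_arcs D \<Longrightarrow> loop_of D S x \<in> loops D S"
  by (simp add: loops_eq_image)

lemma loop_subset_arcs: "\<gamma> \<in> loops D S \<Longrightarrow> \<gamma> \<subseteq> diagram_arcs D"
  unfolding loops_eq_image loop_of_def using same_loop_closed[of _ _ D S] by auto

lemma loop_eq_loop_of:
  assumes "\<gamma> \<in> loops D S" "x \<in> \<gamma>"
  shows "\<gamma> = loop_of D S x"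
proof -
  obtain y where y: "\<gamma> = loop_of D S y" using assms(1) unfolding loops_eq_image by blast
  then have "(y, x) \<in> same_loop D S" using assms(2) by (simp add: mem_loop_of)
  then show ?thesis using y by (simp add: loop_of_eq_iff)
qed

lemma loops_disjoint:
  assumes "\<gamma> \<in> loops D S" "\<delta> \<in> loops D S" "\<gamma> \<noteq> \<delta>"
  shows "\<gamma> \<inter> \<delta> = {}"
  using loop_eq_loop_of[OF assms(1)] loop_eq_loop_of[OF assms(2)] assms(3) by auto

lemma mem_own_loop [simp]: "x \<in> loop_of D S x"
  by (simp add: mem_loop_of)

lemma loop_nonempty: "\<gamma> \<in> loops D S \<Longrightarrow> \<gamma> \<noteq> {}"
  unfolding loops_eq_image using mem_own_loop[of _ D S] by (metis imageE empty_iff)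

text \<open>
  Sums over \<open>Z/2\<close> are to be handled by the ring laws, not as parities.
\<close>

declare add_bit_eq_xor [simp del] mult_bit_eq_and [simp del]

text \<open>
  A change of smoothing either merges two loops or splits one. In a virtual diagram a single loop
  may also be turned into a single loop, to which neither map of the complex applies.
\<close>

locale bifurcating_diagram =
  fixes D :: "('c, 'a) link_diagram"
  assumes finite_crossings: "finite (crossings D)"
    and finite_circles: "finite (circles D)"
    and bifurcation: "\<And>S \<tau>. S \<subseteq> crossings D \<Longrightarrow> \<tau> \<in> crossings D - S \<Longrightarrow>
      (end0 D \<tau>, end2 D \<tau>) \<in> same_loop D S \<longleftrightarrow> (end0 D \<tau>, end2 D \<tau>) \<notin> same_loop D (insert \<tau> S)"
begin

abbreviation "x0 \<equiv> end0 D"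
abbreviation "x2 \<equiv> end2 D"

definition merges :: "'c \<Rightarrow> 'c set \<Rightarrow> bool" where
  "merges \<tau> S \<longleftrightarrow> (x0 \<tau>, x2 \<tau>) \<notin> same_loop D S"

lemma finite_arcs: "finite (diagram_arcs D)"
  using finite_crossings finite_circles
  by (auto simp: diagram_arcs_def arcs_at_def split: prod.split)

lemma finite_loops: "finite (loops D S)"
  using finite_arcs by (simp add: loops_eq_image)

lemma same_loop_merge:
  assumes "S \<subseteq> crossings D" "\<tau> \<in> crossings D - S" "merges \<tau> S"
  shows "same_loop D (insert \<tau> S) = join_rel (same_loop D S) (x0 \<tau>) (x2 \<tau>)"
proof -
  have "(x0 \<tau>, x2 \<tau>) \<in> same_loop D (insert \<tau> S)"
    using bifurcation[OF assms(1,2)] assms(3) by (auto simp: merges_def)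
  then have "join_rel (same_loop D (insert \<tau> S)) (x0 \<tau>) (x2 \<tau>) = same_loop D (insert \<tau> S)"
    by (rule join_rel_absorb[OF equiv_same_loop])
  then show ?thesis using join_same_loop_eq[of \<tau> D S] assms(2) by simp
qed

lemma same_loop_split:
  assumes "S \<subseteq> crossings D" "\<tau> \<in> crossings D - S" "\<not> merges \<tau> S"
  shows "same_loop D S = join_rel (same_loop D (insert \<tau> S)) (x0 \<tau>) (x2 \<tau>)"
    "(x0 \<tau>, x2 \<tau>) \<notin> same_loop D (insert \<tau> S)"
proof -
  have *: "(x0 \<tau>, x2 \<tau>) \<in> same_loop D S" using assms(3) by (simp add: merges_def)
  then have "join_rel (same_loop D S) (x0 \<tau>) (x2 \<tau>) = same_loop D S"
    by (rule join_rel_absorb[OF equiv_same_loop])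
  then show "same_loop D S = join_rel (same_loop D (insert \<tau> S)) (x0 \<tau>) (x2 \<tau>)"
    using join_same_loop_eq[of \<tau> D S] assms(2) by simp
  show "(x0 \<tau>, x2 \<tau>) \<notin> same_loop D (insert \<tau> S)"
    using bifurcation[OF assms(1,2)] * by blast
qed

text \<open>
  A split is a merger read backwards. All statements about the change of loops are made for the
  finer state \<open>T\<close> and the coarser state \<open>U\<close>, whichever of the two comes first.
\<close>

definition pinch :: "'c \<Rightarrow> 'c set \<Rightarrow> 'c set \<Rightarrow> bool" where
  "pinch \<tau> T U \<longleftrightarrow> \<tau> \<in> crossings D \<and> (x0 \<tau>, x2 \<tau>) \<notin> same_loop D T \<and>
     same_loop D U = join_rel (same_loop D T) (x0 \<tau>) (x2 \<tau>)"

lemma pinch_cases: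
  assumes "S \<subseteq> crossings D" "\<tau> \<in> crossings D - S"
  shows "if merges \<tau> S then pinch \<tau> S (insert \<tau> S) else pinch \<tau> (insert \<tau> S) S"
  using same_loop_merge[OF assms] same_loop_split[OF assms] assms(2)
  by (auto simp: pinch_def merges_def)

context
  fixes \<tau> T U
  assumes p: "pinch \<tau> T U"
begin

lemma pinch_ends_distinct: "loop_of D T (x0 \<tau>) \<noteq> loop_of D T (x2 \<tau>)"
  using p by (simp add: loop_of_eq_iff pinch_def)

lemma pinch_loop_of:
  "loop_of D U x = (if x \<in> loop_of D T (x0 \<tau>) \<union> loop_of D T (x2 \<tau>)
     then loop_of D T (x0 \<tau>) \<union> loop_of D T (x2 \<tau>) else loop_of D T x)"
proof -
  have "same_loop D U = join_rel (same_loop D T) (x0 \<tau>) (x2 \<tau>)" using p by (simp add: pinch_def)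
  then show ?thesis
    unfolding loop_of_def using join_rel_Image[OF equiv_same_loop, of D T "x0 \<tau>" "x2 \<tau>" x]
    by (auto dest: same_loop_sym)
qed

lemma pinch_ends_joined: "loop_of D U (x0 \<tau>) = loop_of D T (x0 \<tau>) \<union> loop_of D T (x2 \<tau>)"
  "loop_of D U (x2 \<tau>) = loop_of D T (x0 \<tau>) \<union> loop_of D T (x2 \<tau>)"
  by (simp_all add: pinch_loop_of)

lemma pinch_in_loops:
  "loop_of D T (x0 \<tau>) \<in> loops D T" "loop_of D T (x2 \<tau>) \<in> loops D T"
  "loop_of D T (x0 \<tau>) \<union> loop_of D T (x2 \<tau>) \<in> loops D U"
  using ends_in_arcs[of \<tau> D] p pinch_ends_joined(1)
  by (auto simp: pinch_def intro: loop_of_in_loops) (metis loop_of_in_loops)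

lemma pinch_loops:
  "loops D U = loops D T - {loop_of D T (x0 \<tau>), loop_of D T (x2 \<tau>)}
     \<union> {loop_of D T (x0 \<tau>) \<union> loop_of D T (x2 \<tau>)}"
proof -
  have "x0 \<tau> \<in> diagram_arcs D" "x2 \<tau> \<in> diagram_arcs D"
    using p ends_in_arcs by (auto simp: pinch_def)
  then show ?thesis using p quotient_join_rel[OF equiv_same_loop]
    by (simp add: loops_def loop_of_def pinch_def)
qed

lemma pinch_joined_new: "loop_of D T (x0 \<tau>) \<union> loop_of D T (x2 \<tau>) \<notin> loops D T"
proof
  assume "loop_of D T (x0 \<tau>) \<union> loop_of D T (x2 \<tau>) \<in> loops D T"
  then have "loop_of D T (x0 \<tau>) \<union> loop_of D T (x2 \<tau>) = loop_of D T (x0 \<tau>)"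
    "loop_of D T (x0 \<tau>) \<union> loop_of D T (x2 \<tau>) = loop_of D T (x2 \<tau>)"
    by (rule loop_eq_loop_of, simp)+
  then show False using pinch_ends_distinct by simp
qed

lemma pinch_card: "card (loops D T) = card (loops D U) + 1"
proof -
  have "card (loops D U) + of_bool ((x0 \<tau>, x2 \<tau>) \<notin> same_loop D T) = card (loops D T)"
    using p card_quotient_join_rel[OF equiv_same_loop finite_arcs, of "x0 \<tau>" "x2 \<tau>" D T]
      ends_in_arcs[of \<tau> D]
    unfolding pinch_def loops_def by metis
  then show ?thesis using p by (simp add: pinch_def)
qed

end

lemma card_loops_step:
  assumes "S \<subseteq> crossings D" "\<tau> \<in> crossings D - S"
  shows "int (card (loops D (insert \<tau> S))) = int (card (loops D S)) + (if merges \<tau> S then -1 else 1)"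
  using pinch_cases[OF assms] pinch_card by (auto split: if_splits)

lemma arcs_at_in_ends:
  assumes "\<tau> \<in> crossings D" "\<tau> \<notin> S"
  shows "arcs_at D \<tau> \<subseteq> loop_of D S (x0 \<tau>) \<union> loop_of D S (x2 \<tau>)" "x0 \<tau> \<in> arcs_at D \<tau>" "x2 \<tau> \<in> arcs_at D \<tau>"
proof -
  obtain y0 y1 y2 y3 where pd: "pd D \<tau> = (y0, y1, y2, y3)" by (cases "pd D \<tau>") auto
  then show "arcs_at D \<tau> \<subseteq> loop_of D S (x0 \<tau>) \<union> loop_of D S (x2 \<tau>)"
    using joins_at(1,2)[OF pd assms]
    by (simp add: arcs_at_def end0_def end2_def mem_loop_of)
  show "x0 \<tau> \<in> arcs_at D \<tau>" "x2 \<tau> \<in> arcs_at D \<tau>"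
    using pd by (simp_all add: arcs_at_def end0_def end2_def)
qed

lemma resmoothings_iff:
  assumes "S \<subseteq> crossings D" "\<tau> \<in> crossings D - S"
  shows "(S', l') \<in> resmoothings D \<tau> (S, l) \<longleftrightarrow>
    S' = insert \<tau> S \<and> l' \<in> loops D S' \<rightarrow>\<^sub>E UNIV \<and>
    (\<forall>\<gamma>\<in>loops D S - {loop_of D S (x0 \<tau>), loop_of D S (x2 \<tau>)}. l' \<gamma> = l \<gamma>) \<and>
    (if merges \<tau> S
     then l' (loop_of D S' (x0 \<tau>)) \<in> label_mult (l (loop_of D S (x0 \<tau>))) (l (loop_of D S (x2 \<tau>)))
     else (l' (loop_of D S' (x0 \<tau>)), l' (loop_of D S' (x2 \<tau>))) \<in> label_comult (l (loop_of D S (x0 \<tau>))))"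
proof -
  obtain y0 y1 y2 y3 where pd: "pd D \<tau> = (y0, y1, y2, y3)" by (cases "pd D \<tau>") auto
  then have y: "x0 \<tau> = y0" "x2 \<tau> = y2" by (auto simp: end0_def end2_def)
  have far: "\<gamma> \<inter> arcs_at D \<tau> = {} \<longleftrightarrow> \<gamma> \<noteq> loop_of D S (x0 \<tau>) \<and> \<gamma> \<noteq> loop_of D S (x2 \<tau>)"
    if "\<gamma> \<in> loops D S" for \<gamma>
  proof
    assume "\<gamma> \<inter> arcs_at D \<tau> = {}"
    then have "x0 \<tau> \<notin> \<gamma>" "x2 \<tau> \<notin> \<gamma>" using arcs_at_in_ends(2,3)[of \<tau> S] assms(2) by auto
    then show "\<gamma> \<noteq> loop_of D S (x0 \<tau>) \<and> \<gamma> \<noteq> loop_of D S (x2 \<tau>)" by auto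
  next
    assume *: "\<gamma> \<noteq> loop_of D S (x0 \<tau>) \<and> \<gamma> \<noteq> loop_of D S (x2 \<tau>)"
    have "x0 \<tau> \<in> diagram_arcs D" "x2 \<tau> \<in> diagram_arcs D" using ends_in_arcs assms(2) by auto
    then have "\<gamma> \<inter> loop_of D S (x0 \<tau>) = {}" "\<gamma> \<inter> loop_of D S (x2 \<tau>) = {}"
      using * loops_disjoint[OF that] loop_of_in_loops by metis+
    then show "\<gamma> \<inter> arcs_at D \<tau> = {}" using arcs_at_in_ends(1)[of \<tau> S] assms(2) by blast
  qed
  have sub: "insert \<tau> S \<subseteq> crossings D" using assms by auto
  have m: "loop_of D S y0 \<noteq> loop_of D S y2 \<longleftrightarrow> merges \<tau> S"
    by (simp add: merges_def loop_of_eq_iff y)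
  have far': "(\<forall>\<gamma>\<in>loops D S. \<gamma> \<inter> arcs_at D \<tau> = {} \<longrightarrow> l' \<gamma> = l \<gamma>) \<longleftrightarrow>
     (\<forall>\<gamma>\<in>loops D S - {loop_of D S (x0 \<tau>), loop_of D S (x2 \<tau>)}. l' \<gamma> = l \<gamma>)"
    using far by auto
  have "(S', l') \<in> resmoothings D \<tau> (S, l) \<longleftrightarrow> (S', l') \<in> enhanced_states D \<and> S' = insert \<tau> S \<and>
      (\<forall>\<gamma>\<in>loops D S. \<gamma> \<inter> arcs_at D \<tau> = {} \<longrightarrow> l' \<gamma> = l \<gamma>) \<and>
      (if loop_of D S y0 \<noteq> loop_of D S y2
       then l' (loop_of D S' y0) \<in> label_mult (l (loop_of D S y0)) (l (loop_of D S y2))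
       else (l' (loop_of D S' y0), l' (loop_of D S' y2)) \<in> label_comult (l (loop_of D S y0)))"
    unfolding resmoothings_def pd prod.case mem_Collect_eq ..
  moreover have "(S', l') \<in> enhanced_states D \<and> S' = insert \<tau> S \<longleftrightarrow>
      S' = insert \<tau> S \<and> l' \<in> loops D S' \<rightarrow>\<^sub>E UNIV"
    using sub unfolding enhanced_states_def by blast
  ultimately show ?thesis
    unfolding m far' y by blast
qed

end


section \<open>Expanding labels into arcs\<close>

context bifurcating_diagram
begin

text \<open>
  Iterating the comultiplication along a loop with arcs \<open>a\<^sub>1, \<dots>, a\<^sub>n\<close> turns the label \<open>X\<close> into
  \<open>X\<^bsub>a\<^sub>1\<^esub> \<cdots> X\<^bsub>a\<^sub>n\<^esub>\<close> and the label \<open>1\<close> into the sum of the products of all but one of these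
  variables. In this way the chains with a given smoothing \<open>S\<close> embed into the commutative ring with
  generators \<open>X\<^sub>a\<close>, one for each arc \<open>a\<close>, and relations \<open>X\<^sub>a\<^sup>2 = 0\<close>, the same ring for every \<open>S\<close>.

  A monomial of that ring is recorded by the set \<open>U\<close> of the variables missing from it. A state
  contributes exactly the monomials for which \<open>U\<close> has one arc on each loop labelled \<open>1\<close> and no
  other arcs. Hence \<open>U\<close> has at most one arc on each loop (\<open>separated\<close>), it determines the labels
  (\<open>labelling\<close>), and \<open>expansion f S U\<close> is the coefficient of its monomial.
\<close>

definition separated :: "'c set \<Rightarrow> 'a set \<Rightarrow> bool" where
  "separated S U \<longleftrightarrow> U \<subseteq> diagram_arcs D \<and> (\<forall>x\<in>U. \<forall>y\<in>U. (x, y) \<in> same_loop D S \<longrightarrow> x = y)"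

definition mark :: "'a set \<Rightarrow> 'a set \<Rightarrow> label" where
  "mark U \<gamma> = (if U \<inter> \<gamma> = {} then LabX else Lab1)"

definition labelling :: "'c set \<Rightarrow> 'a set \<Rightarrow> 'a set \<Rightarrow> label" where
  "labelling S U = restrict (mark U) (loops D S)"

definition expansion :: "(('c, 'a) enhanced_state \<Rightarrow> bit) \<Rightarrow> 'c set \<Rightarrow> 'a set \<Rightarrow> bit" where
  "expansion f S U = (if separated S U then f (S, labelling S U) else 0)"

text \<open>
  Multiplication by \<open>X\<^sub>a\<close>: the monomial with the missing variables \<open>U\<close>, where \<open>a \<notin> U\<close>, arises from
  the one that in addition misses \<open>X\<^sub>a\<close>.
\<close>

definition add_arc :: "'a \<Rightarrow> ('a set \<Rightarrow> bit) \<Rightarrow> 'a set \<Rightarrow> bit" where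
  "add_arc a \<phi> U = (if a \<in> U then 0 else \<phi> (insert a U))"

text \<open>
  Under the embedding, comultiplication is the identity, by coassociativity and
  cocommutativity. Multiplication is multiplication by
  \<open>X\<^bsub>x\<^sub>0\<^esub> + X\<^bsub>x\<^sub>2\<^esub>\<close>, because so is multiplication followed by comultiplication.
\<close>

definition resmoothing_map :: "'c \<Rightarrow> 'c set \<Rightarrow> ('a set \<Rightarrow> bit) \<Rightarrow> 'a set \<Rightarrow> bit" where
  "resmoothing_map \<tau> S \<phi> = (if merges \<tau> S then (\<lambda>U. add_arc (x0 \<tau>) \<phi> U + add_arc (x2 \<tau>) \<phi> U) else \<phi>)"

lemma labelling_in: "labelling S U \<in> loops D S \<rightarrow>\<^sub>E UNIV"
  by (simp add: labelling_def)

lemma eq_labelling_iff: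
  assumes "l \<in> loops D S \<rightarrow>\<^sub>E UNIV"
  shows "l = labelling S U \<longleftrightarrow> (\<forall>\<gamma>\<in>loops D S. l \<gamma> = mark U \<gamma>)"
proof
  assume "\<forall>\<gamma>\<in>loops D S. l \<gamma> = mark U \<gamma>"
  then show "l = labelling S U"
    by (intro PiE_ext[OF assms labelling_in]) (simp add: labelling_def)
qed (simp add: labelling_def)

lemma in_label_comult_iff:
  "(a, b) \<in> label_comult c \<longleftrightarrow> \<not> (a = Lab1 \<and> b = Lab1) \<and> c = (if a = LabX \<and> b = LabX then LabX else Lab1)"
  by (cases a; cases b; cases c) auto

lemma in_label_mult_iff:
  "c \<in> label_mult a b \<longleftrightarrow> (if c = Lab1 then a = Lab1 \<and> b = Lab1 else a \<noteq> b)"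
  by (cases a; cases b; cases c) auto

lemma mark_simps: "mark U \<gamma> = Lab1 \<longleftrightarrow> U \<inter> \<gamma> \<noteq> {}" "mark U \<gamma> = LabX \<longleftrightarrow> U \<inter> \<gamma> = {}"
  by (auto simp: mark_def)

lemma pinch_same_loop:
  assumes "pinch \<tau> T U"
  shows "(x, y) \<in> same_loop D U \<longleftrightarrow> (x, y) \<in> same_loop D T \<or>
    x \<in> loop_of D T (x0 \<tau>) \<and> y \<in> loop_of D T (x2 \<tau>) \<or>
    x \<in> loop_of D T (x2 \<tau>) \<and> y \<in> loop_of D T (x0 \<tau>)"
  using assms by (auto simp: pinch_def join_rel_def loop_of_def)

text \<open>
  The loops of the coarser state are larger, so separating points there is the stronger condition;
  it only adds that the two joined loops do not both contain a point.
\<close>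

lemma separated_pinch_iff:
  assumes p: "pinch \<tau> T J"
  shows "separated J U \<longleftrightarrow> separated T U \<and> \<not> (U \<inter> loop_of D T (x0 \<tau>) \<noteq> {} \<and> U \<inter> loop_of D T (x2 \<tau>) \<noteq> {})"
proof -
  have "loop_of D T (x0 \<tau>) \<inter> loop_of D T (x2 \<tau>) = {}"
    using loops_disjoint pinch_in_loops[OF p] pinch_ends_distinct[OF p] by metis
  then show ?thesis
    unfolding separated_def pinch_same_loop[OF p] by blast
qed

text \<open>
  No term of \<open>\<Delta>\<close> labels both parts of the split loop by \<open>1\<close>, just as a set separated for the
  unsplit loop does not meet both parts. The other labellings of the parts determine the label of
  the split loop.
\<close>

lemma split_relabel_iff:
  assumes S: "S \<subseteq> crossings D" "\<tau> \<in> crossings D - S" and m: "\<not> merges \<tau> S"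
    and U: "separated (insert \<tau> S) U" and l: "l \<in> loops D S \<rightarrow>\<^sub>E UNIV"
  shows "(insert \<tau> S, labelling (insert \<tau> S) U) \<in> resmoothings D \<tau> (S, l)
    \<longleftrightarrow> separated S U \<and> l = labelling S U"
proof -
  let ?T = "insert \<tau> S"
  have p: "pinch \<tau> ?T S" using pinch_cases[OF S] m by simp
  define \<gamma>0 \<gamma>2 where g: "\<gamma>0 = loop_of D ?T (x0 \<tau>)" "\<gamma>2 = loop_of D ?T (x2 \<tau>)"
  note g0 = pinch_in_loops[OF p, folded g]
  have J: "loop_of D S (x0 \<tau>) = \<gamma>0 \<union> \<gamma>2" "loop_of D S (x2 \<tau>) = \<gamma>0 \<union> \<gamma>2"
    using pinch_ends_joined[OF p] by (simp_all add: g)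
  have L: "loops D S = loops D ?T - {\<gamma>0, \<gamma>2} \<union> {\<gamma>0 \<union> \<gamma>2}"
    using pinch_loops[OF p] by (simp add: g)
  have new: "\<gamma>0 \<union> \<gamma>2 \<notin> loops D ?T" using pinch_joined_new[OF p] by (simp add: g)
  have lab: "labelling ?T U \<gamma> = mark U \<gamma>" if "\<gamma> \<in> loops D ?T" for \<gamma>
    using that by (simp add: labelling_def)
  have "(?T, labelling ?T U) \<in> resmoothings D \<tau> (S, l) \<longleftrightarrow>
      (\<forall>\<gamma>\<in>loops D ?T - {\<gamma>0, \<gamma>2}. labelling ?T U \<gamma> = l \<gamma>) \<and>
      (labelling ?T U \<gamma>0, labelling ?T U \<gamma>2) \<in> label_comult (l (\<gamma>0 \<union> \<gamma>2))"
  proof -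
    have "loops D S - {\<gamma>0 \<union> \<gamma>2, \<gamma>0 \<union> \<gamma>2} = loops D ?T - {\<gamma>0, \<gamma>2}"
      using L new by blast
    then show ?thesis
      unfolding resmoothings_iff[OF S] J g[symmetric] using m labelling_in by simp
  qed
  also have "\<dots> \<longleftrightarrow> (\<forall>\<gamma>\<in>loops D ?T - {\<gamma>0, \<gamma>2}. mark U \<gamma> = l \<gamma>) \<and>
      (mark U \<gamma>0, mark U \<gamma>2) \<in> label_comult (l (\<gamma>0 \<union> \<gamma>2))"
    using lab g0 by simp
  also have "(mark U \<gamma>0, mark U \<gamma>2) \<in> label_comult (l (\<gamma>0 \<union> \<gamma>2)) \<longleftrightarrow>
      \<not> (U \<inter> \<gamma>0 \<noteq> {} \<and> U \<inter> \<gamma>2 \<noteq> {}) \<and> l (\<gamma>0 \<union> \<gamma>2) = mark U (\<gamma>0 \<union> \<gamma>2)"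
  proof -
    have "(if mark U \<gamma>0 = LabX \<and> mark U \<gamma>2 = LabX then LabX else Lab1) = mark U (\<gamma>0 \<union> \<gamma>2)"
      unfolding mark_def by (simp add: Int_Un_distrib)
    then show ?thesis unfolding in_label_comult_iff mark_simps(1) by simp
  qed
  also have "(\<forall>\<gamma>\<in>loops D ?T - {\<gamma>0, \<gamma>2}. mark U \<gamma> = l \<gamma>) \<and>
      \<not> (U \<inter> \<gamma>0 \<noteq> {} \<and> U \<inter> \<gamma>2 \<noteq> {}) \<and> l (\<gamma>0 \<union> \<gamma>2) = mark U (\<gamma>0 \<union> \<gamma>2)
      \<longleftrightarrow> separated S U \<and> l = labelling S U"
    unfolding separated_pinch_iff[OF p, folded g] eq_labelling_iff[OF l] L
    using U by (simp only: ball_Un ball_simps eq_commute[of "mark U _" "l _"] simp_thms) blast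
  finally show ?thesis .
qed

text \<open>
  Among the two merged loops, one more than in the result is labelled \<open>1\<close>. The missing point
  can be put at \<open>x\<^sub>0\<close> or at \<open>x\<^sub>2\<close>: both are possible, with different labels, if \<open>U\<close> has no point on
  either loop, and exactly one of them is possible if it has a point on one of the loops.
\<close>

lemma merge_relabel_iff:
  assumes S: "S \<subseteq> crossings D" "\<tau> \<in> crossings D - S" and m: "merges \<tau> S"
    and U: "separated (insert \<tau> S) U" and l: "l \<in> loops D S \<rightarrow>\<^sub>E UNIV"
  defines "P \<equiv> \<lambda>a. a \<notin> U \<and> separated S (insert a U) \<and> l = labelling S (insert a U)"
  shows "(insert \<tau> S, labelling (insert \<tau> S) U) \<in> resmoothings D \<tau> (S, l) \<longleftrightarrow> P (x0 \<tau>) \<or> P (x2 \<tau>)"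
    "\<not> (P (x0 \<tau>) \<and> P (x2 \<tau>))"
proof -
  let ?T = "insert \<tau> S"
  have p: "pinch \<tau> S ?T" using pinch_cases[OF S] m by simp
  define \<gamma>0 \<gamma>2 where g: "\<gamma>0 = loop_of D S (x0 \<tau>)" "\<gamma>2 = loop_of D S (x2 \<tau>)"
  note g0 = pinch_in_loops[OF p, folded g]
  have ne: "\<gamma>0 \<noteq> \<gamma>2" using pinch_ends_distinct[OF p] by (simp add: g)
  have disj: "\<gamma>0 \<inter> \<gamma>2 = {}" using loops_disjoint[OF g0(1,2) ne] .
  have ends0: "x0 \<tau> \<in> \<gamma>0" "x2 \<tau> \<in> \<gamma>2" by (simp_all add: g)
  have ends: "x0 \<tau> \<in> \<gamma>0" "x2 \<tau> \<in> \<gamma>2" "x0 \<tau> \<notin> \<gamma>2" "x2 \<tau> \<notin> \<gamma>0" using disj ends0 by blast+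
  have arcs: "x0 \<tau> \<in> diagram_arcs D" "x2 \<tau> \<in> diagram_arcs D" using ends_in_arcs S(2) by auto
  have J: "loop_of D ?T (x0 \<tau>) = \<gamma>0 \<union> \<gamma>2"
    using pinch_ends_joined[OF p] by (simp add: g)
  have L: "loops D ?T = loops D S - {\<gamma>0, \<gamma>2} \<union> {\<gamma>0 \<union> \<gamma>2}"
    using pinch_loops[OF p] by (simp add: g)
  have lab: "labelling ?T U \<gamma> = mark U \<gamma>" if "\<gamma> \<in> loops D ?T" for \<gamma>
    using that by (simp add: labelling_def)
  have one: "\<not> (U \<inter> \<gamma>0 \<noteq> {} \<and> U \<inter> \<gamma>2 \<noteq> {})" and US: "separated S U"
    using U unfolding separated_pinch_iff[OF p, folded g] by auto
  have "(?T, labelling ?T U) \<in> resmoothings D \<tau> (S, l) \<longleftrightarrow>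
      (\<forall>\<gamma>\<in>loops D S - {\<gamma>0, \<gamma>2}. labelling ?T U \<gamma> = l \<gamma>) \<and>
      labelling ?T U (\<gamma>0 \<union> \<gamma>2) \<in> label_mult (l \<gamma>0) (l \<gamma>2)"
    unfolding resmoothings_iff[OF S] J g[symmetric] using m labelling_in by simp
  also have "\<dots> \<longleftrightarrow> (\<forall>\<gamma>\<in>loops D S - {\<gamma>0, \<gamma>2}. l \<gamma> = mark U \<gamma>) \<and>
      mark U (\<gamma>0 \<union> \<gamma>2) \<in> label_mult (l \<gamma>0) (l \<gamma>2)"
  proof -
    have "\<forall>\<gamma>\<in>loops D S - {\<gamma>0, \<gamma>2}. labelling ?T U \<gamma> = mark U \<gamma>"
      "labelling ?T U (\<gamma>0 \<union> \<gamma>2) = mark U (\<gamma>0 \<union> \<gamma>2)"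
      using lab unfolding L by blast+
    then show ?thesis by metis
  qed
  also have "\<dots> \<longleftrightarrow> (\<forall>\<gamma>\<in>loops D S - {\<gamma>0, \<gamma>2}. l \<gamma> = mark U \<gamma>) \<and>
     (if U \<inter> \<gamma>0 \<noteq> {} \<or> U \<inter> \<gamma>2 \<noteq> {} then l \<gamma>0 = Lab1 \<and> l \<gamma>2 = Lab1 else l \<gamma>0 \<noteq> l \<gamma>2)"
    unfolding in_label_mult_iff mark_simps by (simp add: Int_Un_distrib)
  finally have res: "(?T, labelling ?T U) \<in> resmoothings D \<tau> (S, l) \<longleftrightarrow> \<dots>" .
  have mark_far: "mark (insert a U) \<gamma> = mark U \<gamma>" if "\<gamma> \<in> loops D S - {\<gamma>0, \<gamma>2}" "a \<in> {x0 \<tau>, x2 \<tau>}" for a \<gamma>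
  proof -
    have "\<gamma> \<inter> \<gamma>0 = {}" "\<gamma> \<inter> \<gamma>2 = {}" using that(1) loops_disjoint g0(1,2) by blast+
    then have "a \<notin> \<gamma>" using that(2) ends by blast
    then show ?thesis by (simp add: mark_def)
  qed
  have Pa: "P a \<longleftrightarrow> U \<inter> \<gamma> = {} \<and> (\<forall>\<gamma>\<in>loops D S - {\<gamma>0, \<gamma>2}. l \<gamma> = mark U \<gamma>) \<and>
      l \<gamma> = Lab1 \<and> l \<delta> = mark U \<delta>"
    if "a = x0 \<tau> \<and> \<gamma> = \<gamma>0 \<and> \<delta> = \<gamma>2 \<or> a = x2 \<tau> \<and> \<gamma> = \<gamma>2 \<and> \<delta> = \<gamma>0" for a \<gamma> \<delta>
  proof -
    have "\<gamma> = loop_of D S a \<and> a \<in> \<gamma> \<and> a \<notin> \<delta> \<and> a \<in> diagram_arcs D \<and> a \<in> {x0 \<tau>, x2 \<tau>} \<and>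
        {\<gamma>, \<delta>} = {\<gamma>0, \<gamma>2} \<and> \<gamma> \<in> loops D S \<and> \<delta> \<in> loops D S"
      using that by (elim disjE) (simp_all add: ends arcs g0 insert_commute g[symmetric])
    then have a: "\<gamma> = loop_of D S a" "a \<in> \<gamma>" "a \<notin> \<delta>" "a \<in> diagram_arcs D" "a \<in> {x0 \<tau>, x2 \<tau>}"
      "{\<gamma>, \<delta>} = {\<gamma>0, \<gamma>2}" "\<gamma> \<in> loops D S" "\<delta> \<in> loops D S"
      by blast+
    have "separated S (insert a U) \<longleftrightarrow> (\<forall>y\<in>U. (a, y) \<in> same_loop D S \<longrightarrow> a = y)"
      using US a(4) same_loop_sym[of _ _ D S] unfolding separated_def by blast
    then have "a \<notin> U \<and> separated S (insert a U) \<longleftrightarrow> (\<forall>y\<in>U. (a, y) \<notin> same_loop D S)"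
      using same_loop_refl[of a D S] by blast
    then have "a \<notin> U \<and> separated S (insert a U) \<longleftrightarrow> U \<inter> \<gamma> = {}"
      using mem_loop_of[of _ D S a] unfolding a(1) by blast
    moreover have "l = labelling S (insert a U) \<longleftrightarrow>
       (\<forall>\<gamma>\<in>loops D S - {\<gamma>0, \<gamma>2}. l \<gamma> = mark U \<gamma>) \<and> l \<gamma> = Lab1 \<and> l \<delta> = mark U \<delta>"
    proof -
      have "mark (insert a U) \<gamma> = Lab1" "mark (insert a U) \<delta> = mark U \<delta>"
        using a(2,3) by (auto simp: mark_def)
      moreover have "loops D S = (loops D S - {\<gamma>0, \<gamma>2}) \<union> {\<gamma>, \<delta>}" using a(6-8) by auto
      ultimately show ?thesis
        unfolding eq_labelling_iff[OF l] using mark_far[OF _ a(5)]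
        by (metis (no_types, lifting) Un_iff insert_iff empty_iff)
    qed
    ultimately show ?thesis unfolding P_def by blast
  qed
  note P0 = Pa[of "x0 \<tau>" \<gamma>0 \<gamma>2] and P2 = Pa[of "x2 \<tau>" \<gamma>2 \<gamma>0]
  show "(insert \<tau> S, labelling (insert \<tau> S) U) \<in> resmoothings D \<tau> (S, l) \<longleftrightarrow> P (x0 \<tau>) \<or> P (x2 \<tau>)"
    unfolding res P0[simplified] P2[simplified] using one
    by (cases "U \<inter> \<gamma>0 = {}"; cases "U \<inter> \<gamma>2 = {}"; cases "l \<gamma>0"; cases "l \<gamma>2"; simp add: mark_def)
  show "\<not> (P (x0 \<tau>) \<and> P (x2 \<tau>))"
    unfolding P0[simplified] P2[simplified] by (auto simp: mark_def)
qed


text \<open>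
  Outside of the separated sets the embedded chains have coefficient \<open>0\<close>, and the ring operations
  respect this.
\<close>

lemma resmoothing_map_unseparated:
  assumes S: "S \<subseteq> crossings D" "\<tau> \<in> crossings D - S" and U: "\<not> separated (insert \<tau> S) U"
  shows "resmoothing_map \<tau> S (expansion f S) U = 0"
proof (cases "merges \<tau> S")
  case False
  then have "pinch \<tau> (insert \<tau> S) S" using pinch_cases[OF S] by simp
  then show ?thesis using U False by (simp add: resmoothing_map_def expansion_def separated_pinch_iff)
next
  case True
  have p: "pinch \<tau> S (insert \<tau> S)" using pinch_cases[OF S] True by simp
  have "add_arc a (expansion f S) U = 0" if a: "a = x0 \<tau> \<or> a = x2 \<tau>" for a
  proof -
    have "a \<in> U" if M: "separated S (insert a U)"
    proof (rule ccontr)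
      assume "a \<notin> U"
      have "separated S U" using M unfolding separated_def by blast
      then obtain y z where yz: "y \<in> U" "z \<in> U" "y \<in> loop_of D S (x0 \<tau>)" "z \<in> loop_of D S (x2 \<tau>)"
        using U unfolding separated_pinch_iff[OF p] by blast
      then have "(x0 \<tau>, y) \<in> same_loop D S" "(x2 \<tau>, z) \<in> same_loop D S" by (simp_all add: mem_loop_of)
      with a yz(1,2) M \<open>a \<notin> U\<close> show False unfolding separated_def by blast
    qed
    then show ?thesis by (auto simp: add_arc_def expansion_def)
  qed
  then show ?thesis using True by (simp add: resmoothing_map_def)
qed

lemma finite_labels: "finite (loops D S \<rightarrow>\<^sub>E (UNIV :: label set))"
proof -
  have "(UNIV :: label set) = {Lab1, LabX}" using label.exhaust by auto
  then have "finite (UNIV :: label set)" by (metis finite.emptyI finite_insert)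
  then show ?thesis using finite_loops by (intro finite_PiE) auto
qed

lemma sum_resmoothings:
  assumes S: "S \<subseteq> crossings D" "\<tau> \<in> crossings D - S" and U: "separated (insert \<tau> S) U"
  shows "(\<Sum>l\<in>loops D S \<rightarrow>\<^sub>E UNIV. f (S, l) *
      of_bool ((insert \<tau> S, labelling (insert \<tau> S) U) \<in> resmoothings D \<tau> (S, l)))
    = resmoothing_map \<tau> S (expansion f S) U"
proof -
  have pick: "(\<Sum>l\<in>loops D S \<rightarrow>\<^sub>E UNIV. f (S, l) * of_bool (C \<and> l = labelling S V))
      = (if C then f (S, labelling S V) else 0)" for C V
  proof -
    have "(\<Sum>l\<in>loops D S \<rightarrow>\<^sub>E UNIV. f (S, l) * of_bool (C \<and> l = labelling S V))
      = (\<Sum>l\<in>loops D S \<rightarrow>\<^sub>E UNIV. if l = labelling S V then (if C then f (S, labelling S V) else 0) else 0)"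
      by (rule sum.cong) auto
    then show ?thesis using labelling_in[of S V] finite_labels[of S] by (simp only: sum.delta if_True)
  qed
  show ?thesis
  proof (cases "merges \<tau> S")
    case False
    have "(\<Sum>l\<in>loops D S \<rightarrow>\<^sub>E UNIV. f (S, l) *
        of_bool ((insert \<tau> S, labelling (insert \<tau> S) U) \<in> resmoothings D \<tau> (S, l)))
      = (\<Sum>l\<in>loops D S \<rightarrow>\<^sub>E UNIV. f (S, l) * of_bool (separated S U \<and> l = labelling S U))"
      using split_relabel_iff[OF S False U] by (intro sum.cong) auto
    also have "\<dots> = resmoothing_map \<tau> S (expansion f S) U"
      using False by (simp only: pick resmoothing_map_def expansion_def if_False)
    finally show ?thesis .
  next
    case True
    let ?P = "\<lambda>a l. (a \<notin> U \<and> separated S (insert a U)) \<and> l = labelling S (insert a U)"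
    have "(\<Sum>l\<in>loops D S \<rightarrow>\<^sub>E UNIV. f (S, l) *
        of_bool ((insert \<tau> S, labelling (insert \<tau> S) U) \<in> resmoothings D \<tau> (S, l)))
      = (\<Sum>l\<in>loops D S \<rightarrow>\<^sub>E UNIV. f (S, l) * of_bool (?P (x0 \<tau>) l) + f (S, l) * of_bool (?P (x2 \<tau>) l))"
    proof (rule sum.cong[OF refl])
      fix l :: "'a set \<Rightarrow> label" assume l: "l \<in> loops D S \<rightarrow>\<^sub>E UNIV"
      have "of_bool (A \<or> B) = (of_bool A + of_bool B :: bit)" if "\<not> (A \<and> B)" for A B
        using that by auto
      from this[OF merge_relabel_iff(2)[OF S True U l]] merge_relabel_iff(1)[OF S True U l]
      show "f (S, l) * of_bool ((insert \<tau> S, labelling (insert \<tau> S) U) \<in> resmoothings D \<tau> (S, l))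
        = f (S, l) * of_bool (?P (x0 \<tau>) l) + f (S, l) * of_bool (?P (x2 \<tau>) l)"
        by (simp only: distrib_left conj_assoc)
    qed
    also have "\<dots> = add_arc (x0 \<tau>) (expansion f S) U + add_arc (x2 \<tau>) (expansion f S) U"
      unfolding sum.distrib pick by (simp add: add_arc_def expansion_def)
    finally show ?thesis using True by (simp add: resmoothing_map_def)
  qed
qed

lemma finite_enhanced_states: "finite (enhanced_states D)"
  unfolding enhanced_states_def using finite_crossings finite_labels by (intro finite_SigmaI) auto

text \<open>
  The pairs of a predecessor state and a site that can lead to \<open>S'\<close> correspond to the sites
  with a B-smoothing in \<open>S'\<close>.
\<close>

lemma expansion_differential:
  assumes S': "S' \<subseteq> crossings D"
  shows "expansion (differential D f) S' U = (\<Sum>\<tau>\<in>S'. resmoothing_map \<tau> (S' - {\<tau>}) (expansion f (S' - {\<tau>})) U)"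
proof (cases "separated S' U")
  case False
  have "resmoothing_map \<tau> (S' - {\<tau>}) (expansion f (S' - {\<tau>})) U = 0" if "\<tau> \<in> S'" for \<tau>
  proof (rule resmoothing_map_unseparated)
    show "S' - {\<tau>} \<subseteq> crossings D" "\<tau> \<in> crossings D - (S' - {\<tau>})" using S' that by auto
    show "\<not> separated (insert \<tau> (S' - {\<tau>})) U" using False that by (simp add: insert_absorb)
  qed
  then show ?thesis using False by (simp add: expansion_def)
next
  case True
  let ?s = "(S', labelling S' U)"
  let ?g = "\<lambda>\<tau> S l. f (S, l) * of_bool (?s \<in> resmoothings D \<tau> (S, l))"
  have finS: "finite S'" using S' finite_crossings by (rule finite_subset)
  have "differential D f ?s = (\<Sum>s\<in>enhanced_states D. \<Sum>\<tau>\<in>crossings D - fst s. f s * of_bool (?s \<in> resmoothings D \<tau> s))"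
    unfolding differential_def by (simp only: sum_distrib_left)
  also have "\<dots> = (\<Sum>(S, l)\<in>enhanced_states D. \<Sum>\<tau>\<in>crossings D - S. ?g \<tau> S l)"
    by (simp add: case_prod_unfold)
  also have "\<dots> = (\<Sum>S\<in>Pow (crossings D). \<Sum>l\<in>loops D S \<rightarrow>\<^sub>E UNIV. \<Sum>\<tau>\<in>crossings D - S. ?g \<tau> S l)"
    unfolding enhanced_states_def using finite_crossings finite_labels
    by (subst sum.Sigma) auto
  also have "\<dots> = (\<Sum>S\<in>Pow (crossings D). \<Sum>\<tau>\<in>crossings D - S. \<Sum>l\<in>loops D S \<rightarrow>\<^sub>E UNIV. ?g \<tau> S l)"
    by (intro sum.cong refl sum.swap)
  also have "\<dots> = (\<Sum>(S, \<tau>)\<in>(SIGMA S:Pow (crossings D). crossings D - S). \<Sum>l\<in>loops D S \<rightarrow>\<^sub>E UNIV. ?g \<tau> S l)"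
    using finite_crossings by (subst sum.Sigma) auto
  also have "\<dots> = (\<Sum>(S, \<tau>)\<in>(\<lambda>\<tau>. (S' - {\<tau>}, \<tau>)) ` S'. \<Sum>l\<in>loops D S \<rightarrow>\<^sub>E UNIV. ?g \<tau> S l)"
  proof (rule sum.mono_neutral_right)
    show "finite (SIGMA S:Pow (crossings D). crossings D - S)" using finite_crossings by auto
    show "(\<lambda>\<tau>. (S' - {\<tau>}, \<tau>)) ` S' \<subseteq> (SIGMA S:Pow (crossings D). crossings D - S)" using S' by auto
    show "\<forall>i\<in>(SIGMA S:Pow (crossings D). crossings D - S) - (\<lambda>\<tau>. (S' - {\<tau>}, \<tau>)) ` S'.
       (case i of (S, \<tau>) \<Rightarrow> \<Sum>l\<in>loops D S \<rightarrow>\<^sub>E UNIV. ?g \<tau> S l) = 0"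
    proof
      fix i assume i: "i \<in> (SIGMA S:Pow (crossings D). crossings D - S) - (\<lambda>\<tau>. (S' - {\<tau>}, \<tau>)) ` S'"
      obtain S \<tau> where [simp]: "i = (S, \<tau>)" by (cases i)
      have S: "S \<subseteq> crossings D" "\<tau> \<in> crossings D - S" using i by auto
      have "S' \<noteq> insert \<tau> S"
      proof
        assume "S' = insert \<tau> S"
        then have "i = (S' - {\<tau>}, \<tau>)" "\<tau> \<in> S'" using S(2) by auto
        then show False using i by blast
      qed
      then have "?s \<notin> resmoothings D \<tau> (S, l)" for l
        unfolding resmoothings_iff[OF S] by blast
      then show "(case i of (S, \<tau>) \<Rightarrow> \<Sum>l\<in>loops D S \<rightarrow>\<^sub>E UNIV. ?g \<tau> S l) = 0" by simp
    qed
  qed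
  also have "\<dots> = (\<Sum>\<tau>\<in>S'. \<Sum>l\<in>loops D (S' - {\<tau>}) \<rightarrow>\<^sub>E UNIV. ?g \<tau> (S' - {\<tau>}) l)"
    by (subst sum.reindex) (auto intro: inj_onI)
  also have "\<dots> = (\<Sum>\<tau>\<in>S'. resmoothing_map \<tau> (S' - {\<tau>}) (expansion f (S' - {\<tau>})) U)"
  proof (rule sum.cong[OF refl])
    fix \<tau> assume "\<tau> \<in> S'"
    then have *: "S' - {\<tau>} \<subseteq> crossings D" "\<tau> \<in> crossings D - (S' - {\<tau>})" "insert \<tau> (S' - {\<tau>}) = S'"
      using S' by auto
    show "(\<Sum>l\<in>loops D (S' - {\<tau>}) \<rightarrow>\<^sub>E UNIV. ?g \<tau> (S' - {\<tau>}) l) = resmoothing_map \<tau> (S' - {\<tau>}) (expansion f (S' - {\<tau>})) U"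
      using sum_resmoothings[OF *(1,2), of U f] True unfolding *(3) by simp
  qed
  finally show ?thesis using True by (simp add: expansion_def)
qed

text \<open>
  A state is recovered from any set with one point on each of its loops labelled \<open>1\<close>.
\<close>

lemma expansion_inj:
  assumes supp: "\<And>s. f s \<noteq> 0 \<Longrightarrow> s \<in> enhanced_states D"
    and zero: "\<And>S U. S \<subseteq> crossings D \<Longrightarrow> expansion f S U = 0"
  shows "f = (\<lambda>s. 0)"
proof (rule ccontr)
  assume "f \<noteq> (\<lambda>s. 0)"
  then obtain S l where Sl: "f (S, l) \<noteq> 0" by fastforce
  then have "(S, l) \<in> enhanced_states D" using supp by blast
  then have S: "S \<subseteq> crossings D" and l: "l \<in> loops D S \<rightarrow>\<^sub>E UNIV"
    unfolding enhanced_states_def by auto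
  define pt where "pt \<gamma> = (SOME x. x \<in> \<gamma>)" for \<gamma> :: "'a set"
  have pt: "pt \<gamma> \<in> \<gamma>" if "\<gamma> \<in> loops D S" for \<gamma>
    using loop_nonempty[OF that] unfolding pt_def by (meson ex_in_conv someI_ex)
  define U where "U = pt ` {\<gamma> \<in> loops D S. l \<gamma> = Lab1}"
  have eq: "\<gamma> = \<delta>" if "\<gamma> \<in> loops D S" "\<delta> \<in> loops D S" "x \<in> \<gamma>" "x \<in> \<delta>" for x \<gamma> \<delta>
    using loops_disjoint[OF that(1,2)] that(3,4) by blast
  have "separated S U"
    unfolding separated_def
  proof (intro conjI ballI impI)
    show "U \<subseteq> diagram_arcs D" using pt loop_subset_arcs unfolding U_def by blast
    fix x y assume "x \<in> U" "y \<in> U" and xy: "(x, y) \<in> same_loop D S"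
    then obtain \<gamma> \<delta> where gd: "\<gamma> \<in> loops D S" "x = pt \<gamma>" "\<delta> \<in> loops D S" "y = pt \<delta>" unfolding U_def by blast
    then have "\<gamma> = loop_of D S x" "\<delta> = loop_of D S y" using pt loop_eq_loop_of by metis+
    then show "x = y" using xy gd loop_of_eq_iff by metis
  qed
  moreover have "l = labelling S U"
    unfolding eq_labelling_iff[OF l]
  proof
    fix \<gamma> assume g: "\<gamma> \<in> loops D S"
    show "l \<gamma> = mark U \<gamma>"
    proof (cases "l \<gamma>")
      case Lab1
      then have "pt \<gamma> \<in> U \<inter> \<gamma>" using g pt unfolding U_def by blast
      then show ?thesis using Lab1 mark_simps(1) by (metis empty_iff)
    next
      case LabX
      have "U \<inter> \<gamma> = {}"
      proof (rule ccontr)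
        assume "U \<inter> \<gamma> \<noteq> {}"
        then obtain \<delta> where "\<delta> \<in> loops D S" "l \<delta> = Lab1" "pt \<delta> \<in> \<gamma>" unfolding U_def by blast
        then have "\<delta> = \<gamma>" using eq pt g by blast
        then show False using \<open>l \<delta> = Lab1\<close> LabX by simp
      qed
      then show ?thesis using LabX by (simp add: mark_def)
    qed
  qed
  ultimately have "expansion f S U = f (S, l)" by (simp add: expansion_def)
  then show False using zero[OF S] Sl by simp
qed

end


section \<open>The differential squares to zero and preserves the quantum grading\<close>

lemma bit_add_self: "(b :: bit) + b = 0"
  by (cases b) simp_all

lemma sum_symmetric_char_2:
  fixes g :: "'c \<Rightarrow> 'c \<Rightarrow> 'b :: comm_monoid_add"
  assumes char_2: "\<And>b :: 'b. b + b = 0"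
    and "finite A" and "\<And>x y. x \<in> A \<Longrightarrow> y \<in> A \<Longrightarrow> x \<noteq> y \<Longrightarrow> g x y = g y x"
  shows "(\<Sum>x\<in>A. \<Sum>y\<in>A - {x}. g x y) = 0"
  using assms(2,3)
proof (induction A rule: finite_induct)
  case empty
  show ?case by simp
next
  case (insert a A)
  have "(\<Sum>y\<in>insert a A - {x}. g x y) = g x a + (\<Sum>y\<in>A - {x}. g x y)" if "x \<in> A" for x
  proof -
    have "insert a A - {x} = insert a (A - {x})" using that insert.hyps by auto
    then show ?thesis using insert.hyps by simp
  qed
  then have "(\<Sum>x\<in>insert a A. \<Sum>y\<in>insert a A - {x}. g x y)
      = (\<Sum>y\<in>A. g a y) + ((\<Sum>x\<in>A. g x a) + (\<Sum>x\<in>A. \<Sum>y\<in>A - {x}. g x y))"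
    using insert.hyps by (simp add: sum.distrib)
  also have "(\<Sum>x\<in>A. \<Sum>y\<in>A - {x}. g x y) = 0"
    using insert.prems by (intro insert.IH) auto
  also have "(\<Sum>x\<in>A. g x a) = (\<Sum>y\<in>A. g a y)"
    using insert.prems insert.hyps by (intro sum.cong) auto
  finally show ?case by (simp only: char_2 add_0_right)
qed

context bifurcating_diagram
begin

lemma add_arc_commute: "add_arc a (add_arc b \<phi>) = add_arc b (add_arc a \<phi>)"
  by (rule ext) (auto simp: add_arc_def insert_commute)

lemma add_arc_add: "add_arc a (\<lambda>U. \<phi> U + \<psi> U) = (\<lambda>U. add_arc a \<phi> U + add_arc a \<psi> U)"
  by (rule ext) (simp add: add_arc_def)

lemma add_arc_sum: "add_arc a (\<lambda>U. \<Sum>i\<in>I. \<phi> i U) = (\<lambda>U. \<Sum>i\<in>I. add_arc a (\<phi> i) U)"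
  by (rule ext) (simp add: add_arc_def)

lemma resmoothing_map_sum: "resmoothing_map \<tau> S (\<lambda>U. \<Sum>i\<in>I. \<phi> i U) = (\<lambda>U. \<Sum>i\<in>I. resmoothing_map \<tau> S (\<phi> i) U)"
  by (simp add: resmoothing_map_def add_arc_sum sum.distrib)

text \<open>
  The variables of two arcs on one loop act in the same way on the image of the embedding: both
  turn the label \<open>1\<close> of that loop into \<open>X\<close>.
\<close>

lemma add_arc_expansion_cong:
  assumes ab: "(a, b) \<in> same_loop D S" and "a \<in> diagram_arcs D" "b \<in> diagram_arcs D"
  shows "add_arc a (expansion f S) = add_arc b (expansion f S)"
proof
  fix U
  have one_way: "add_arc a (expansion f S) U = add_arc b (expansion f S) U"
    if ab: "(a, b) \<in> same_loop D S" and arcs: "a \<in> diagram_arcs D" "b \<in> diagram_arcs D"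
      and a: "a \<notin> U" "separated S (insert a U)" for a b
  proof -
    have b: "b \<notin> U"
    proof
      assume "b \<in> U"
      then have "a = b" using a(2) ab unfolding separated_def by blast
      then show False using \<open>b \<in> U\<close> a(1) by simp
    qed
    have "(a, y) \<notin> same_loop D S" if "y \<in> U" for y
      using a that unfolding separated_def by blast
    then have nb: "(b, y) \<notin> same_loop D S" if "y \<in> U" for y
      using that ab same_loop_trans by metis
    have m: "separated S (insert b U)"
      using a(2) arcs(2) nb same_loop_sym[of _ b D S] unfolding separated_def by blast
    have "insert a U \<inter> \<gamma> = {} \<longleftrightarrow> insert b U \<inter> \<gamma> = {}" if g: "\<gamma> \<in> loops D S" for \<gamma>
    proof -
      have "a \<in> \<gamma> \<longleftrightarrow> b \<in> \<gamma>"
        using ab same_loop_sym[OF ab] loop_eq_loop_of[OF g] mem_loop_of by metis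
      then show ?thesis by auto
    qed
    then have "labelling S (insert a U) = labelling S (insert b U)"
      unfolding labelling_def mark_def by (intro restrict_ext) simp
    then show ?thesis using a b m by (simp add: add_arc_def expansion_def)
  qed
  show "add_arc a (expansion f S) U = add_arc b (expansion f S) U"
  proof (cases "a \<notin> U \<and> separated S (insert a U)")
    case True
    then show ?thesis using one_way[of a b] assms by blast
  next
    case a: False
    show ?thesis
    proof (cases "b \<notin> U \<and> separated S (insert b U)")
      case True
      then show ?thesis using one_way[of b a] assms same_loop_sym[OF ab] by metis
    next
      case False
      then show ?thesis using a by (auto simp: add_arc_def expansion_def)
    qed
  qed
qed

text \<open>
  The maps around the square are identities or multiplications by \<open>X\<^bsub>x\<^sub>0\<^esub> + X\<^bsub>x\<^sub>2\<^esub>\<close> at one of the two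
  crossings, in a commutative ring. Both ways around change the number of loops by the same amount.
  So the factors can differ only if both crossings merge before, and split after, the other one has
  been changed, or conversely. In the first case both merge the same two loops, and the factors act
  in the same way. In the second case the ends of each crossing lie on one loop, and both factors
  act as \<open>X\<^sub>a + X\<^sub>a = 0\<close>.
\<close>

lemma square_commutes:
  assumes S: "S \<subseteq> crossings D" and \<tau>: "\<tau> \<in> crossings D - S" and \<rho>: "\<rho> \<in> crossings D - S" and ne: "\<tau> \<noteq> \<rho>"
  shows "resmoothing_map \<rho> (insert \<tau> S) (resmoothing_map \<tau> S (expansion f S)) = resmoothing_map \<tau> (insert \<rho> S) (resmoothing_map \<rho> S (expansion f S))"
proof -
  have S1: "insert \<tau> S \<subseteq> crossings D" "\<rho> \<in> crossings D - insert \<tau> S" using S \<tau> \<rho> ne by auto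
  have S2: "insert \<rho> S \<subseteq> crossings D" "\<tau> \<in> crossings D - insert \<rho> S" using S \<tau> \<rho> ne by auto
  have arcs: "x0 \<tau> \<in> diagram_arcs D" "x2 \<tau> \<in> diagram_arcs D" "x0 \<rho> \<in> diagram_arcs D" "x2 \<rho> \<in> diagram_arcs D"
    using ends_in_arcs \<tau> \<rho> by auto
  let ?\<phi> = "expansion f S"
  let ?A = "\<lambda>\<tau> \<phi> U. add_arc (x0 \<tau>) \<phi> U + add_arc (x2 \<tau>) \<phi> U"
  have comm: "?A \<rho> (?A \<tau> ?\<phi>) = ?A \<tau> (?A \<rho> ?\<phi>)"
    by (simp add: add_arc_add add_arc_commute[of "x0 \<rho>"] add_arc_commute[of "x2 \<rho>"] add_ac)
  have count: "(if merges \<tau> S then - 1 else 1) + (if merges \<rho> (insert \<tau> S) then - 1 else 1)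
      = (if merges \<rho> S then - 1 else 1) + (if merges \<tau> (insert \<rho> S) then - 1 else 1 :: int)"
    using card_loops_step[OF S \<tau>] card_loops_step[OF S \<rho>] card_loops_step[OF S1] card_loops_step[OF S2]
    unfolding insert_commute[of \<rho> \<tau> S] by linarith
  consider "merges \<rho> (insert \<tau> S) = merges \<rho> S" "merges \<tau> (insert \<rho> S) = merges \<tau> S"
    | "merges \<tau> S" "merges \<rho> S" "\<not> merges \<rho> (insert \<tau> S)" "\<not> merges \<tau> (insert \<rho> S)"
    | "\<not> merges \<tau> S" "\<not> merges \<rho> S" "merges \<rho> (insert \<tau> S)" "merges \<tau> (insert \<rho> S)"
    using count by (cases "merges \<tau> S"; cases "merges \<rho> S"; cases "merges \<rho> (insert \<tau> S)"; cases "merges \<tau> (insert \<rho> S)") auto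
  then show ?thesis
  proof cases
    case 1
    then show ?thesis unfolding resmoothing_map_def using comm by simp
  next
    case 2
    have "(x0 \<rho>, x2 \<rho>) \<in> same_loop D (insert \<tau> S)" "(x0 \<rho>, x2 \<rho>) \<notin> same_loop D S"
      using 2(2,3) by (auto simp: merges_def)
    then have "x0 \<rho> \<in> loop_of D S (x0 \<tau>) \<and> x2 \<rho> \<in> loop_of D S (x2 \<tau>) \<or>
        x0 \<rho> \<in> loop_of D S (x2 \<tau>) \<and> x2 \<rho> \<in> loop_of D S (x0 \<tau>)"
      using pinch_same_loop[of \<tau> S "insert \<tau> S"] pinch_cases[OF S \<tau>] 2(1) by auto
    then have "?A \<tau> ?\<phi> = ?A \<rho> ?\<phi>"
    proof (elim disjE conjE)
      assume "x0 \<rho> \<in> loop_of D S (x0 \<tau>)" "x2 \<rho> \<in> loop_of D S (x2 \<tau>)"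
      then have "add_arc (x0 \<tau>) ?\<phi> = add_arc (x0 \<rho>) ?\<phi>" "add_arc (x2 \<tau>) ?\<phi> = add_arc (x2 \<rho>) ?\<phi>"
        using arcs by (auto simp: mem_loop_of intro!: add_arc_expansion_cong)
      then show ?thesis by simp
    next
      assume "x0 \<rho> \<in> loop_of D S (x2 \<tau>)" "x2 \<rho> \<in> loop_of D S (x0 \<tau>)"
      then have "add_arc (x2 \<tau>) ?\<phi> = add_arc (x0 \<rho>) ?\<phi>" "add_arc (x0 \<tau>) ?\<phi> = add_arc (x2 \<rho>) ?\<phi>"
        using arcs by (auto simp: mem_loop_of intro!: add_arc_expansion_cong)
      then show ?thesis by (simp add: add.commute)
    qed
    then show ?thesis using 2 by (simp add: resmoothing_map_def)
  next
    case 3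
    have "?A \<sigma> ?\<phi> = (\<lambda>U. 0)" if "\<sigma> = \<tau> \<or> \<sigma> = \<rho>" for \<sigma>
    proof -
      have "add_arc (x0 \<sigma>) ?\<phi> = add_arc (x2 \<sigma>) ?\<phi>"
        using that 3(1,2) arcs by (auto simp: merges_def intro!: add_arc_expansion_cong)
      then show ?thesis by (simp only: bit_add_self)
    qed
    then show ?thesis using 3 by (simp add: resmoothing_map_def)
  qed
qed

lemma differential_nonzeroE:
  assumes "differential D f s' \<noteq> 0"
  obtains s \<tau> where "s \<in> enhanced_states D" "f s \<noteq> 0" "\<tau> \<in> crossings D - fst s" "s' \<in> resmoothings D \<tau> s"
proof -
  from assms obtain s where s: "s \<in> enhanced_states D"
    "f s * (\<Sum>\<tau>\<in>crossings D - fst s. of_bool (s' \<in> resmoothings D \<tau> s)) \<noteq> 0"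
    unfolding differential_def by (metis (no_types, lifting) sum.not_neutral_contains_not_neutral)
  then have nz: "f s \<noteq> 0" "(\<Sum>\<tau>\<in>crossings D - fst s. of_bool (s' \<in> resmoothings D \<tau> s) :: bit) \<noteq> 0"
    by (metis mult_zero_left, metis mult_zero_right)
  from nz(2) obtain \<tau> where "\<tau> \<in> crossings D - fst s" "(of_bool (s' \<in> resmoothings D \<tau> s) :: bit) \<noteq> 0"
    by (rule sum.not_neutral_contains_not_neutral)
  then show thesis using that s(1) nz(1) by (auto split: if_splits)
qed

lemma resmoothings_enhanced: "s' \<in> resmoothings D \<tau> s \<Longrightarrow> s' \<in> enhanced_states D"
  by (cases s; cases s'; cases "pd D \<tau>") (simp add: resmoothings_def)

lemma differential_supp: "differential D f s \<noteq> 0 \<Longrightarrow> s \<in> enhanced_states D"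
  by (metis differential_nonzeroE resmoothings_enhanced)

text \<open>
  The expansion of \<open>\<partial>\<partial>\<close> is a sum over ordered pairs of sites, in which the two orders of a pair
  cancel.
\<close>

theorem differential_squared: "differential D (differential D f) = (\<lambda>s. 0)"
proof (rule expansion_inj)
  fix S U assume S: "S \<subseteq> crossings D"
  have "expansion (differential D (differential D f)) S U
    = (\<Sum>\<tau>\<in>S. resmoothing_map \<tau> (S - {\<tau>}) (expansion (differential D f) (S - {\<tau>})) U)"
    by (rule expansion_differential[OF S])
  also have "\<dots> = (\<Sum>\<tau>\<in>S. \<Sum>\<rho>\<in>S - {\<tau>}.
      resmoothing_map \<tau> (S - {\<tau>}) (resmoothing_map \<rho> (S - {\<tau>} - {\<rho>}) (expansion f (S - {\<tau>} - {\<rho>}))) U)"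
  proof (rule sum.cong[OF refl])
    fix \<tau> assume "\<tau> \<in> S"
    have "S - {\<tau>} \<subseteq> crossings D" using S by auto
    then have "expansion (differential D f) (S - {\<tau>}) = (\<lambda>U. \<Sum>\<rho>\<in>S - {\<tau>}. resmoothing_map \<rho> (S - {\<tau>} - {\<rho>}) (expansion f (S - {\<tau>} - {\<rho>})) U)"
      by (intro ext expansion_differential)
    then show "resmoothing_map \<tau> (S - {\<tau>}) (expansion (differential D f) (S - {\<tau>})) U
      = (\<Sum>\<rho>\<in>S - {\<tau>}. resmoothing_map \<tau> (S - {\<tau>}) (resmoothing_map \<rho> (S - {\<tau>} - {\<rho>}) (expansion f (S - {\<tau>} - {\<rho>}))) U)"
      by (simp only: resmoothing_map_sum)
  qed
  also have "\<dots> = 0"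
  proof (rule sum_symmetric_char_2[OF bit_add_self])
    show "finite S" using S finite_crossings by (rule finite_subset)
    fix \<tau> \<rho> assume tr: "\<tau> \<in> S" "\<rho> \<in> S" "\<tau> \<noteq> \<rho>"
    let ?S = "S - {\<tau>} - {\<rho>}"
    have "?S \<subseteq> crossings D" "\<tau> \<in> crossings D - ?S" "\<rho> \<in> crossings D - ?S" using S tr by auto
    from square_commutes[OF this tr(3), of f]
    have "resmoothing_map \<rho> (insert \<tau> ?S) (resmoothing_map \<tau> ?S (expansion f ?S)) = resmoothing_map \<tau> (insert \<rho> ?S) (resmoothing_map \<rho> ?S (expansion f ?S))" .
    moreover have "insert \<tau> ?S = S - {\<rho>}" "insert \<rho> ?S = S - {\<tau>}" "S - {\<rho>} - {\<tau>} = ?S" using tr by auto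
    ultimately show "resmoothing_map \<tau> (S - {\<tau>}) (resmoothing_map \<rho> ?S (expansion f ?S)) U
      = resmoothing_map \<rho> (S - {\<rho>}) (resmoothing_map \<tau> (S - {\<rho>} - {\<tau>}) (expansion f (S - {\<rho>} - {\<tau>}))) U"
      by metis
  qed
  finally show "expansion (differential D (differential D f)) S U = 0" .
qed (rule differential_supp)


fun weight :: "label \<Rightarrow> int" where
  "weight Lab1 = 1"
| "weight LabX = -1"

lemma label_excess_eq_sum: "label_excess D s = (\<Sum>\<gamma>\<in>loops D (fst s). weight (snd s \<gamma>))"
proof -
  let ?L = "loops D (fst s)"
  have "(\<Sum>\<gamma>\<in>?L. weight (snd s \<gamma>)) = (\<Sum>\<gamma>\<in>?L. of_bool (snd s \<gamma> = Lab1) - of_bool (snd s \<gamma> = LabX))"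
  proof (rule sum.cong[OF refl])
    fix \<gamma> show "weight (snd s \<gamma>) = of_bool (snd s \<gamma> = Lab1) - of_bool (snd s \<gamma> = LabX)"
      by (cases "snd s \<gamma>") auto
  qed
  then show ?thesis
    unfolding label_excess_def sum_subtractf using finite_loops[of "fst s"]
    by (simp add: sum_of_bool_eq Int_def)
qed

lemma pinch_sum:
  fixes g :: "'a set \<Rightarrow> int"
  assumes p: "pinch \<tau> T J"
  shows "(\<Sum>\<gamma>\<in>loops D T. g \<gamma>) - g (loop_of D T (x0 \<tau>)) - g (loop_of D T (x2 \<tau>))
    = (\<Sum>\<gamma>\<in>loops D T - {loop_of D T (x0 \<tau>), loop_of D T (x2 \<tau>)}. g \<gamma>)"
    "(\<Sum>\<gamma>\<in>loops D J. g \<gamma>) - g (loop_of D T (x0 \<tau>) \<union> loop_of D T (x2 \<tau>))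
    = (\<Sum>\<gamma>\<in>loops D T - {loop_of D T (x0 \<tau>), loop_of D T (x2 \<tau>)}. g \<gamma>)"
proof -
  let ?p = "loop_of D T (x0 \<tau>)" and ?q = "loop_of D T (x2 \<tau>)"
  note ends = pinch_in_loops(1,2)[OF p]
  have "loops D T = insert ?p (insert ?q (loops D T - {?p, ?q}))" using ends by auto
  then have "(\<Sum>\<gamma>\<in>loops D T. g \<gamma>) = (\<Sum>\<gamma>\<in>insert ?p (insert ?q (loops D T - {?p, ?q})). g \<gamma>)" by simp
  then show "(\<Sum>\<gamma>\<in>loops D T. g \<gamma>) - g ?p - g ?q = (\<Sum>\<gamma>\<in>loops D T - {?p, ?q}. g \<gamma>)"
    using pinch_ends_distinct[OF p] finite_loops[of T] by simp
  have "loops D J = insert (?p \<union> ?q) (loops D T - {?p, ?q})" using pinch_loops[OF p] by simp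
  then show "(\<Sum>\<gamma>\<in>loops D J. g \<gamma>) - g (?p \<union> ?q) = (\<Sum>\<gamma>\<in>loops D T - {?p, ?q}. g \<gamma>)"
    using pinch_joined_new[OF p] finite_loops[of T] by simp
qed

text \<open>
  Multiplication and comultiplication lower the excess of labels \<open>1\<close> by one, which makes up for
  the new B-smoothing.
\<close>

lemma resmoothings_grading:
  assumes s: "s \<in> enhanced_states D" and \<tau>: "\<tau> \<in> crossings D - fst s" and s': "s' \<in> resmoothings D \<tau> s"
  shows "n_B s' = n_B s + 1" "q_grading D s' = q_grading D s"
proof -
  obtain S l S' l' where [simp]: "s = (S, l)" "s' = (S', l')" by (cases s, cases s') auto
  have S: "S \<subseteq> crossings D" "\<tau> \<in> crossings D - S" using s \<tau> by (auto simp: enhanced_states_def)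
  note R = s'[simplified, unfolded resmoothings_iff[OF S]]
  have S'_eq: "S' = insert \<tau> S" using R by blast
  have far: "\<forall>\<gamma>\<in>loops D S - {loop_of D S (x0 \<tau>), loop_of D S (x2 \<tau>)}. l' \<gamma> = l \<gamma>" using R by blast
  have "finite S" using S(1) finite_crossings by (rule finite_subset)
  then show nB: "n_B s' = n_B s + 1" using S(2) by (simp add: n_B_def S'_eq)
  have "(\<Sum>\<gamma>\<in>loops D S'. weight (l' \<gamma>)) + 1 = (\<Sum>\<gamma>\<in>loops D S. weight (l \<gamma>))"
  proof (cases "merges \<tau> S")
    case True
    then have p: "pinch \<tau> S S'" using pinch_cases[OF S] S'_eq by simp
    let ?p = "loop_of D S (x0 \<tau>)" and ?q = "loop_of D S (x2 \<tau>)"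
    have "(\<Sum>\<gamma>\<in>loops D S - {?p, ?q}. weight (l' \<gamma>)) = (\<Sum>\<gamma>\<in>loops D S - {?p, ?q}. weight (l \<gamma>))"
      using far by (intro sum.cong) auto
    moreover have "weight (l' (?p \<union> ?q)) + 1 = weight (l ?p) + weight (l ?q)"
    proof -
      have "l' (?p \<union> ?q) \<in> label_mult (l ?p) (l ?q)"
        using R True pinch_ends_joined[OF p] by simp
      then show ?thesis by (cases "l ?p"; cases "l ?q") auto
    qed
    ultimately show ?thesis
      using pinch_sum(1)[OF p, of "\<lambda>\<gamma>. weight (l \<gamma>)"] pinch_sum(2)[OF p, of "\<lambda>\<gamma>. weight (l' \<gamma>)"] by linarith
  next
    case False
    then have p: "pinch \<tau> S' S" using pinch_cases[OF S] S'_eq by simp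
    let ?p = "loop_of D S' (x0 \<tau>)" and ?q = "loop_of D S' (x2 \<tau>)"
    have J: "loop_of D S (x0 \<tau>) = ?p \<union> ?q" "loop_of D S (x2 \<tau>) = ?p \<union> ?q" by (rule pinch_ends_joined[OF p])+
    have "loops D S - {?p \<union> ?q} = loops D S' - {?p, ?q}"
      using pinch_loops[OF p] pinch_joined_new[OF p] by blast
    then have "(\<Sum>\<gamma>\<in>loops D S' - {?p, ?q}. weight (l' \<gamma>)) = (\<Sum>\<gamma>\<in>loops D S' - {?p, ?q}. weight (l \<gamma>))"
      using far[unfolded J] by (intro sum.cong) auto
    moreover have "weight (l' ?p) + weight (l' ?q) + 1 = weight (l (?p \<union> ?q))"
    proof -
      have "(l' ?p, l' ?q) \<in> label_comult (l (?p \<union> ?q))"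
        using R[THEN conjunct2, THEN conjunct2, THEN conjunct2] False J by simp
      then show ?thesis by (cases "l (?p \<union> ?q)") auto
    qed
    ultimately show ?thesis
      using pinch_sum(1)[OF p, of "\<lambda>\<gamma>. weight (l' \<gamma>)"] pinch_sum(2)[OF p, of "\<lambda>\<gamma>. weight (l \<gamma>)"] by linarith
  qed
  then show "q_grading D s' = q_grading D s"
    using nB by (simp add: q_grading_def label_excess_eq_sum)
qed

end


section \<open>Dimensions over the field with two elements\<close>

text \<open>
  All spaces here are finite, so dimensions are read off from cardinalities. The relations between
  the dimensions of chains, cycles, boundaries and homology then follow by counting fibres and
  cosets, and only the homology itself has to be recognized as a vector space.
\<close>

lemma card_bit_vectorspace:
  fixes V :: "(bit, 'b, 'x) module_scheme"
  assumes V: "vectorspace class_ring V" and finV: "finite (carrier V)"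
  shows "card (carrier V) = 2 ^ vectorspace.dim class_ring V"
proof -
  interpret vectorspace class_ring V by (rule V)
  have "span (carrier V) = carrier V"
    using span_is_subset2[of "carrier V"] in_own_span[of "carrier V"] by (intro subset_antisym) simp_all
  then have "fin_dim" unfolding fin_dim_def using finV by (intro exI[of _ "carrier V"] conjI subset_refl)
  from finite_basis_exists[OF this] obtain B where B: "finite B" "basis B" by (elim exE conjE)
  then have BV: "B \<subseteq> carrier V" by (simp add: basis_def)
  let ?E = "B \<rightarrow>\<^sub>E (UNIV :: bit set)"
  have ex1: "\<exists>!a. a \<in> ?E \<and> lincomb a B = v" if "v \<in> carrier V" for v
    using basis_criterion[OF B(1) BV] B(2) that by simp
  have "bij_betw (\<lambda>a. lincomb a B) ?E (carrier V)"
    unfolding bij_betw_def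
  proof
    have cl: "lincomb a B \<in> carrier V" for a
      by (rule lincomb_closed[OF BV]) simp
    show "inj_on (\<lambda>a. lincomb a B) ?E"
    proof (rule inj_onI)
      fix a b assume "a \<in> ?E" "b \<in> ?E" "lincomb a B = lincomb b B"
      then show "a = b" using ex1[OF cl[of b]] by (elim ex1E) metis
    qed
    show "(\<lambda>a. lincomb a B) ` ?E = carrier V"
    proof
      show "(\<lambda>a. lincomb a B) ` ?E \<subseteq> carrier V" by (rule image_subsetI) (rule cl)
      show "carrier V \<subseteq> (\<lambda>a. lincomb a B) ` ?E"
      proof
        fix v assume "v \<in> carrier V"
        from ex1[OF this] obtain a where "a \<in> ?E" "lincomb a B = v" by (elim ex1E conjE)
        then show "v \<in> (\<lambda>a. lincomb a B) ` ?E" by (intro image_eqI) simp_all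
      qed
    qed
  qed
  then have "card (carrier V) = card ?E" by (rule bij_betw_same_card[symmetric])
  also have "\<dots> = 2 ^ card B"
  proof -
    have "(UNIV :: bit set) = {0, 1}" using bit_not_zero_iff by blast
    then have "card (UNIV :: bit set) = 2" by (metis card_2_iff zero_neq_one)
    then show ?thesis using B(1) by (simp add: card_PiE)
  qed
  finally show ?thesis using dim_basis[OF B] by simp
qed

text \<open>
  The scalar \<open>0\<close> sends every coset to \<open>N\<close> and the scalar \<open>1\<close> fixes it. Distributivity over
  \<open>1 + 1 = 0\<close> asks for \<open>U + U = N\<close>, which holds because \<open>x + x = 0\<close> in the module.
\<close>

lemma quotient_bit_module:
  fixes M :: "(bit, 'b) module"
  assumes M: "Module.module class_ring M" and N: "additive_subgroup N M"
  shows "vectorspace class_ring (quotient_module M N)"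
    "finite (carrier M) \<Longrightarrow> card (carrier (quotient_module M N)) * card N = card (carrier M)"
proof -
  interpret M: Module.module class_ring M by (rule M)
  have sub: "abelian_subgroup N M" by (rule abelian_subgroupI3[OF N M.abelian_group_axioms])
  interpret N: abelian_subgroup N M by (rule sub)
  let ?Q = "quotient_module M N"
  have Q: "carrier ?Q = a_rcosets\<^bsub>M\<^esub> N" "zero ?Q = N" "add ?Q = set_add M"
    by (simp_all add: quotient_module_def)
  have char_2: "x \<oplus>\<^bsub>M\<^esub> x = \<zero>\<^bsub>M\<^esub>" if "x \<in> carrier M" for x
  proof -
    have "((1::bit) + 1) \<odot>\<^bsub>M\<^esub> x = x \<oplus>\<^bsub>M\<^esub> x"
      using M.smult_l_distr[of 1 1 x] M.smult_one[OF that] that by simp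
    moreover have "(0::bit) \<odot>\<^bsub>M\<^esub> x = \<zero>\<^bsub>M\<^esub>"
      using M.smult_l_null[OF that] by simp
    ultimately show ?thesis by (metis bit_add_self)
  qed
  have cosetE: "\<exists>x\<in>carrier M. U = N +>\<^bsub>M\<^esub> x" if "U \<in> a_rcosets\<^bsub>M\<^esub> N" for U
    using that by (simp add: A_RCOSETS_def')
  have N_coset: "N +>\<^bsub>M\<^esub> \<zero>\<^bsub>M\<^esub> = N" by (rule M.a_coset_add_zero[OF N.a_subset])
  have smult0: "(0::bit) \<odot>\<^bsub>?Q\<^esub> U = N" if U: "U \<in> a_rcosets\<^bsub>M\<^esub> N" for U
  proof -
    from cosetE[OF U] obtain x where x: "x \<in> carrier M" "U = N +>\<^bsub>M\<^esub> x" by (elim bexE)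
    have "x \<in> U" unfolding x(2) by (rule N.a_rcos_self[OF x(1)])
    have "U \<subseteq> carrier M" unfolding x(2) by (rule M.a_r_coset_subset_G[OF N.a_subset x(1)])
    have "N +>\<^bsub>M\<^esub> ((0::bit) \<odot>\<^bsub>M\<^esub> u) = N" if "u \<in> U" for u
      using M.smult_l_null[of u] subsetD[OF \<open>U \<subseteq> carrier M\<close> that] N_coset by simp
    then have "(\<Union>u\<in>U. N +>\<^bsub>M\<^esub> ((0::bit) \<odot>\<^bsub>M\<^esub> u)) = (\<Union>u\<in>U. N)" by (intro SUP_cong refl)
    also have "\<dots> = N" using \<open>x \<in> U\<close> by (intro SUP_const) (rule notI, simp)
    finally show ?thesis by (simp add: quotient_module_def)
  qed
  have smult1: "(1::bit) \<odot>\<^bsub>?Q\<^esub> U = U" if U: "U \<in> a_rcosets\<^bsub>M\<^esub> N" for U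
  proof -
    from cosetE[OF U] obtain x where x: "x \<in> carrier M" "U = N +>\<^bsub>M\<^esub> x" by (elim bexE)
    have xU: "x \<in> U" unfolding x(2) by (rule N.a_rcos_self[OF x(1)])
    have "U \<subseteq> carrier M" unfolding x(2) by (rule M.a_r_coset_subset_G[OF N.a_subset x(1)])
    have "N +>\<^bsub>M\<^esub> ((1::bit) \<odot>\<^bsub>M\<^esub> u) = U" if "u \<in> U" for u
      using M.smult_one[of u] subsetD[OF \<open>U \<subseteq> carrier M\<close> that] that x(1)
        M.a_repr_independence[of u N x] N.a_subgroup unfolding x(2) by simp
    then have "(\<Union>u\<in>U. N +>\<^bsub>M\<^esub> ((1::bit) \<odot>\<^bsub>M\<^esub> u)) = (\<Union>u\<in>U. U)" by (intro SUP_cong refl)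
    also have "\<dots> = U" using xU by (intro SUP_const) (rule notI, simp)
    finally show ?thesis by (simp add: quotient_module_def)
  qed
  have smult: "c \<odot>\<^bsub>?Q\<^esub> U = (if c = 0 then N else U)" if "U \<in> a_rcosets\<^bsub>M\<^esub> N" for c :: bit and U
    using smult0[OF that] smult1[OF that] by (cases c) auto
  have NQ: "N \<in> a_rcosets\<^bsub>M\<^esub> N"
    using M.a_rcosetsI[OF N.a_subset M.zero_closed] N_coset by simp
  have NN: "N <+>\<^bsub>M\<^esub> N = N" using N.rcosets_add_eq[OF NQ] .
  have NU: "N <+>\<^bsub>M\<^esub> U = U" if "U \<in> a_rcosets\<^bsub>M\<^esub> N" for U using N.rcosets_add_eq[OF that] .
  interpret F: comm_group "M A_Mod N" by (rule N.a_factorgroup_is_comm_group)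
  have assoc: "(U <+>\<^bsub>M\<^esub> V) <+>\<^bsub>M\<^esub> W = U <+>\<^bsub>M\<^esub> (V <+>\<^bsub>M\<^esub> W)"
    if "U \<in> a_rcosets\<^bsub>M\<^esub> N" "V \<in> a_rcosets\<^bsub>M\<^esub> N" "W \<in> a_rcosets\<^bsub>M\<^esub> N" for U V W
    using F.m_assoc[of U V W] that by (simp add: A_FactGroup_def')
  have comm: "U <+>\<^bsub>M\<^esub> V = V <+>\<^bsub>M\<^esub> U"
    if "U \<in> a_rcosets\<^bsub>M\<^esub> N" "V \<in> a_rcosets\<^bsub>M\<^esub> N" for U V
    using F.m_comm[of U V] that by (simp add: A_FactGroup_def')
  have UN: "U <+>\<^bsub>M\<^esub> N = U" if "U \<in> a_rcosets\<^bsub>M\<^esub> N" for U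
    using comm[OF that NQ] NU[OF that] by simp
  have UU: "U <+>\<^bsub>M\<^esub> U = N" if "U \<in> a_rcosets\<^bsub>M\<^esub> N" for U
  proof -
    from cosetE[OF that] obtain x where "x \<in> carrier M" "U = N +>\<^bsub>M\<^esub> x" by (elim bexE)
    then show ?thesis by (simp add: N.a_rcos_sum char_2 N_coset)
  qed
  have "Module.module class_ring ?Q"
  proof (rule moduleI)
    show "cring (class_ring :: bit ring)" by (rule class_cring.cring_axioms)
    show "abelian_group ?Q"
    proof (rule abelian_groupI, unfold Q)
      fix U assume "U \<in> a_rcosets\<^bsub>M\<^esub> N"
      then show "\<exists>V\<in>a_rcosets\<^bsub>M\<^esub> N. V <+>\<^bsub>M\<^esub> U = N" by (intro bexI[of _ U] UU)
    qed (rule N.a_setmult_closed NQ assoc comm NU; assumption)+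
    fix a b :: bit and U V assume UV: "U \<in> carrier ?Q" "V \<in> carrier ?Q"
    then have U: "U \<in> a_rcosets\<^bsub>M\<^esub> N" and V: "V \<in> a_rcosets\<^bsub>M\<^esub> N" by (simp_all add: Q)
    have W: "U <+>\<^bsub>M\<^esub> V \<in> a_rcosets\<^bsub>M\<^esub> N" using N.a_setmult_closed[OF U V] .
    show "a \<odot>\<^bsub>?Q\<^esub> (U \<oplus>\<^bsub>?Q\<^esub> V) = a \<odot>\<^bsub>?Q\<^esub> U \<oplus>\<^bsub>?Q\<^esub> a \<odot>\<^bsub>?Q\<^esub> V"
      unfolding Q smult[OF U] smult[OF V] smult[OF W] by (simp add: NN)
  next
    fix a b :: bit and U assume "U \<in> carrier ?Q"
    then have U: "U \<in> a_rcosets\<^bsub>M\<^esub> N" by (simp add: Q)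
    show "a \<odot>\<^bsub>?Q\<^esub> U \<in> carrier ?Q" unfolding Q smult[OF U] using U NQ by simp
    show "(a \<oplus>\<^bsub>class_ring\<^esub> b) \<odot>\<^bsub>?Q\<^esub> U = a \<odot>\<^bsub>?Q\<^esub> U \<oplus>\<^bsub>?Q\<^esub> b \<odot>\<^bsub>?Q\<^esub> U"
      unfolding Q smult[OF U] by (cases a; cases b) (simp_all add: smult[OF U] NN NU[OF U] UN[OF U] UU[OF U] bit_add_self)
    show "(a \<otimes>\<^bsub>class_ring\<^esub> b) \<odot>\<^bsub>?Q\<^esub> U = a \<odot>\<^bsub>?Q\<^esub> (b \<odot>\<^bsub>?Q\<^esub> U)"
      unfolding smult[OF U] by (cases a; cases b) (simp_all add: smult[OF U] smult[OF NQ])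
    show "\<one>\<^bsub>class_ring\<^esub> \<odot>\<^bsub>?Q\<^esub> U = U" by (simp add: smult1[OF U])
  qed
  then show "vectorspace class_ring ?Q"
    unfolding vectorspace_def by (intro conjI class_field)
  show "card (carrier ?Q) * card N = card (carrier M)" if "finite (carrier M)"
    using M.a_lagrange[OF that N] unfolding Q Coset.order_def .
qed

lemma card_functions_on_bit:
  assumes "finite A"
  shows "card {f :: 'b \<Rightarrow> bit. \<forall>s. f s \<noteq> 0 \<longrightarrow> s \<in> A} = 2 ^ card A"
    "finite {f :: 'b \<Rightarrow> bit. \<forall>s. f s \<noteq> 0 \<longrightarrow> s \<in> A}"
proof -
  let ?F = "{f :: 'b \<Rightarrow> bit. \<forall>s. f s \<noteq> 0 \<longrightarrow> s \<in> A}"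
  have b: "bij_betw (\<lambda>f. {s. f s \<noteq> 0}) ?F (Pow A)"
  proof (rule bij_betwI[where g = "\<lambda>B s. of_bool (s \<in> B)"])
    fix f assume "f \<in> ?F"
    show "(\<lambda>s. of_bool (s \<in> {s. f s \<noteq> 0})) = f"
    proof
      fix s show "of_bool (s \<in> {s. f s \<noteq> 0}) = f s" by (cases "f s") auto
    qed
  qed auto
  show "card ?F = 2 ^ card A" using bij_betw_same_card[OF b] card_Pow[OF assms] by simp
  show "finite ?F" using bij_betw_finite[OF b] assms by simp
qed

text \<open>
  Every nonempty fibre of an additive map is a translate of its kernel.
\<close>

lemma card_kernel_image_bit:
  fixes h :: "('b \<Rightarrow> bit) \<Rightarrow> ('b \<Rightarrow> bit)"
  assumes fin: "finite A" and closed: "\<And>f g. f \<in> A \<Longrightarrow> g \<in> A \<Longrightarrow> (\<lambda>s. f s + g s) \<in> A"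
    and add: "\<And>f g. h (\<lambda>s. f s + g s) = (\<lambda>s. h f s + h g s)"
  shows "card {f \<in> A. h f = (\<lambda>s. 0)} * card (h ` A) = card A"
proof -
  have self: "(\<lambda>s. f s + (f s + g s)) = g" for f g :: "'b \<Rightarrow> bit"
    by (rule ext) (metis add.assoc add_0_left bit_add_self)
  have fib: "card {f \<in> A. h f = y} = card {f \<in> A. h f = (\<lambda>s. 0)}" if y: "y \<in> h ` A" for y
  proof -
    obtain g where g: "g \<in> A" "y = h g" using y by blast
    have "bij_betw (\<lambda>f s. g s + f s) {f \<in> A. h f = (\<lambda>s. 0)} {f \<in> A. h f = y}"
    proof (rule bij_betwI[where g = "\<lambda>f s. g s + f s"])
      show "(\<lambda>f s. g s + f s) \<in> {f \<in> A. h f = (\<lambda>s. 0)} \<rightarrow> {f \<in> A. h f = y}"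
        using closed[OF g(1)] add[of g] g(2) by auto
      show "(\<lambda>f s. g s + f s) \<in> {f \<in> A. h f = y} \<rightarrow> {f \<in> A. h f = (\<lambda>s. 0)}"
        using closed[OF g(1)] add[of g] g(2) by (auto simp: bit_add_self)
    qed (simp_all add: self)
    then show ?thesis by (rule bij_betw_same_card[symmetric])
  qed
  have "card A = (\<Sum>y\<in>h ` A. card {f \<in> A. h f = y})"
    using sum.image_gen[OF fin, of "\<lambda>_. 1 :: nat" h] by simp
  also have "\<dots> = card {f \<in> A. h f = (\<lambda>s. 0)} * card (h ` A)"
    by (simp add: fib mult.commute)
  finally show ?thesis ..
qed

text \<open>
  Read \<open>h, b, z, c\<close> as the dimensions of homology, boundaries, cycles and chains.
\<close>

lemma alternating_telescope:
  fixes h b c z :: "nat \<Rightarrow> nat"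
  assumes "\<And>i. h i + b i = z i" "\<And>i. z i + b (Suc i) = c i" "b 0 = 0"
  shows "(\<Sum>i\<le>n. (-1) ^ i * int (h i)) = (\<Sum>i\<le>n. (-1) ^ i * int (c i)) - (-1) ^ n * int (b (Suc n))"
proof (induction n)
  case 0
  show ?case using assms(1)[of 0] assms(2)[of 0] assms(3) by simp
next
  case (Suc n)
  have c: "int (c (Suc n)) = int (h (Suc n)) + int (b (Suc (Suc n))) + int (b (Suc n))"
    using assms(1)[of "Suc n"] assms(2)[of "Suc n"] by linarith
  show ?case unfolding sum.atMost_Suc Suc c by (simp add: algebra_simps)
qed


section \<open>The Euler characteristic of Khovanov homology\<close>

context bifurcating_diagram
begin

definition graded_states :: "int \<Rightarrow> int \<Rightarrow> ('c, 'a) enhanced_state set" where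
  "graded_states i j = {s \<in> enhanced_states D. n_B s = i \<and> q_grading D s = j}"

definition chains :: "int \<Rightarrow> int \<Rightarrow> (('c, 'a) enhanced_state \<Rightarrow> bit) set" where
  "chains i j = carrier (chain_space D i j)"

lemma chains_eq: "chains i j = {f. \<forall>s. f s \<noteq> 0 \<longrightarrow> s \<in> graded_states i j}"
  by (simp add: chains_def chain_space_def graded_states_def)

lemma finite_graded_states: "finite (graded_states i j)"
  using finite_enhanced_states by (simp add: graded_states_def)

lemma card_chains: "card (chains i j) = 2 ^ card (graded_states i j)"
  and finite_chains: "finite (chains i j)"
  unfolding chains_eq by (rule card_functions_on_bit[OF finite_graded_states])+

lemma chains_add: "f \<in> chains i j \<Longrightarrow> g \<in> chains i j \<Longrightarrow> (\<lambda>s. f s + g s) \<in> chains i j"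
  unfolding chains_eq mem_Collect_eq
proof (intro allI impI)
  fix s assume fg: "\<forall>s. f s \<noteq> 0 \<longrightarrow> s \<in> graded_states i j" "\<forall>s. g s \<noteq> 0 \<longrightarrow> s \<in> graded_states i j"
    and "f s + g s \<noteq> 0"
  then have "f s \<noteq> 0 \<or> g s \<noteq> 0" by (cases "f s") simp_all
  then show "s \<in> graded_states i j" using fg by blast
qed

lemma differential_add:
  "differential D (\<lambda>s. f s + g s) = (\<lambda>s. differential D f s + differential D g s)"
  unfolding differential_def by (simp only: distrib_right sum.distrib)

lemma differential_chains:
  assumes "f \<in> chains i j"
  shows "differential D f \<in> chains (i + 1) j"
  unfolding chains_eq mem_Collect_eq
proof (intro allI impI)
  fix s' assume "differential D f s' \<noteq> 0"
  then obtain s \<tau> where s: "s \<in> enhanced_states D" "f s \<noteq> 0" "\<tau> \<in> crossings D - fst s" "s' \<in> resmoothings D \<tau> s"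
    by (rule differential_nonzeroE)
  then have "s \<in> graded_states i j" using assms unfolding chains_eq by blast
  then have "n_B s = i" "q_grading D s = j" by (simp_all add: graded_states_def)
  then show "s' \<in> graded_states (i + 1) j"
    using resmoothings_grading[OF s(1,3,4)] resmoothings_enhanced[OF s(4)] by (simp add: graded_states_def)
qed

definition cycles :: "int \<Rightarrow> int \<Rightarrow> (('c, 'a) enhanced_state \<Rightarrow> bit) set" where
  "cycles i j = {f \<in> chains i j. differential D f = (\<lambda>s. 0)}"

definition boundaries :: "int \<Rightarrow> int \<Rightarrow> (('c, 'a) enhanced_state \<Rightarrow> bit) set" where
  "boundaries i j = differential D ` chains (i - 1) j"

lemma zero_chain: "(\<lambda>s. 0) \<in> chains i j"
  by (simp add: chains_eq)

lemma differential_zero: "differential D (\<lambda>s. 0) = (\<lambda>s. 0)"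
  by (simp add: differential_def)

lemma boundaries_subset: "boundaries i j \<subseteq> cycles i j"
  unfolding boundaries_def cycles_def using differential_squared differential_chains[of _ "i - 1" j] by auto

lemma card_cycles_boundaries: "card (cycles i j) * card (boundaries (i + 1) j) = 2 ^ card (graded_states i j)"
  unfolding cycles_def boundaries_def card_chains[symmetric] add_diff_cancel_right'
  by (rule card_kernel_image_bit[OF finite_chains chains_add differential_add])

lemma homology_eq: "homology D i j = quotient_module ((chain_space D i j)\<lparr>carrier := cycles i j\<rparr>) (boundaries i j)"
  by (simp add: homology_def cycles_def boundaries_def chains_def)

lemma card_homology: "2 ^ vectorspace.dim class_ring (homology D i j) * card (boundaries i j) = card (cycles i j)"
proof -
  let ?M = "(chain_space D i j)\<lparr>carrier := cycles i j\<rparr>"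
  have M: "carrier ?M = cycles i j" "zero ?M = (\<lambda>s. 0)" "add ?M = (\<lambda>f g s. f s + g s)"
    "smult ?M = (\<lambda>c f s. c * f s)"
    by (simp_all add: chain_space_def)
  have cyc_add: "(\<lambda>s. f s + g s) \<in> cycles i j" if "f \<in> cycles i j" "g \<in> cycles i j" for f g
    using that unfolding cycles_def by (simp add: chains_add differential_add)
  have cyc_zero: "(\<lambda>s. 0) \<in> cycles i j" by (simp add: cycles_def zero_chain differential_zero)
  have ab: "abelian_group ?M"
  proof (rule abelian_groupI, unfold M)
    fix f assume "f \<in> cycles i j"
    then show "\<exists>g\<in>cycles i j. (\<lambda>s. g s + f s) = (\<lambda>s. 0)"
      by (intro bexI[of _ f]) (simp_all add: bit_add_self)
  qed (simp_all add: cyc_add cyc_zero add_ac)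
  have mod: "Module.module class_ring ?M"
  proof (rule moduleI)
    show "cring (class_ring :: bit ring)" by (rule class_cring.cring_axioms)
    show "abelian_group ?M" by (rule ab)
    fix c :: bit and f assume "f \<in> carrier ?M"
    then show "c \<odot>\<^bsub>?M\<^esub> f \<in> carrier ?M"
      unfolding M using cyc_zero by (cases c) simp_all
  qed (simp_all add: M distrib_left distrib_right mult.assoc)
  have "boundaries i j \<subseteq> carrier ?M" using boundaries_subset by (simp add: M)
  have sub: "additive_subgroup (boundaries i j) ?M"
  proof (rule additive_subgroup.intro, rule subgroup.intro)
    interpret A: abelian_group ?M by (rule ab)
    show "boundaries i j \<subseteq> carrier (add_monoid ?M)" using boundaries_subset by (simp add: M)
    show "\<one>\<^bsub>add_monoid ?M\<^esub> \<in> boundaries i j"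
      using imageI[OF zero_chain, of "differential D" "i - 1" j] by (simp add: M boundaries_def differential_zero)
    fix f assume f: "f \<in> boundaries i j"
    have "f \<in> cycles i j" using boundaries_subset f by (rule subsetD)
    have "\<ominus>\<^bsub>?M\<^esub> f = f"
      by (rule A.minus_equality) (use \<open>f \<in> cycles i j\<close> in \<open>simp_all add: M bit_add_self\<close>)
    then show "inv\<^bsub>add_monoid ?M\<^esub> f \<in> boundaries i j" using f by (simp add: a_inv_def)
    fix g assume g: "g \<in> boundaries i j"
    show "f \<otimes>\<^bsub>add_monoid ?M\<^esub> g \<in> boundaries i j"
    proof -
      obtain f' g' where "f' \<in> chains (i - 1) j" "g' \<in> chains (i - 1) j" "f = differential D f'" "g = differential D g'"
        using f g unfolding boundaries_def by (elim imageE)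
      then have "(\<lambda>s. f s + g s) = differential D (\<lambda>s. f' s + g' s)" "(\<lambda>s. f' s + g' s) \<in> chains (i - 1) j"
        by (simp_all add: differential_add chains_add)
      then show ?thesis unfolding boundaries_def by (simp add: M)
    qed
  qed
  have fin: "finite (carrier ?M)" using finite_chains by (simp add: M cycles_def)
  note q = quotient_bit_module[OF mod sub]
  have "finite (carrier (quotient_module ?M (boundaries i j)))"
  proof (rule ccontr)
    assume "infinite (carrier (quotient_module ?M (boundaries i j)))"
    then have "card (carrier ?M) = 0" using q(2)[OF fin] by simp
    then show False using fin cyc_zero by (auto simp: M)
  qed
  then show ?thesis
    using card_bit_vectorspace[OF q(1)] q(2)[OF fin] by (simp add: homology_eq M)
qed

text \<open>
  The Euler characteristic does not change under passage to homology; the boundaries vanish in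
  degree \<open>0\<close> and above the number of crossings, so no term is left over at the ends.
\<close>

lemma euler_char_eq:
  "euler_char D j = (\<Sum>i\<le>card (crossings D). (-1) ^ i * int (card (graded_states (int i) j)))"
proof -
  have empty: "graded_states i j = {}" if "i < 0 \<or> i > int (card (crossings D))" for i
  proof -
    have "n_B s \<ge> 0 \<and> n_B s \<le> int (card (crossings D))" if "s \<in> enhanced_states D" for s
    proof -
      have "fst s \<subseteq> crossings D" using that by (auto simp: enhanced_states_def)
      then show ?thesis using card_mono[OF finite_crossings] by (simp add: n_B_def)
    qed
    then show ?thesis using that unfolding graded_states_def by force
  qed
  have triv: "chains i j = {\<lambda>s. 0}" if "i < 0 \<or> i > int (card (crossings D))" for i
    using empty[OF that] unfolding chains_eq by auto
  have "\<exists>b. card (boundaries (int i) j) = 2 ^ b" for i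
  proof -
    have "card (boundaries (int i) j) dvd 2 ^ card (graded_states (int i - 1) j)"
      using card_cycles_boundaries[of "int i - 1" j] by (metis diff_add_cancel dvd_triv_right)
    then show ?thesis using divides_primepow_nat[of 2] two_is_prime_nat by blast
  qed
  then obtain b where b: "\<And>i. card (boundaries (int i) j) = 2 ^ b i" by metis
  let ?h = "\<lambda>i. vectorspace.dim class_ring (homology D (int i) j)"
  let ?c = "\<lambda>i. card (graded_states (int i) j)"
  have z: "card (cycles (int i) j) = 2 ^ (?h i + b i)" for i
    using card_homology[of "int i" j] by (simp add: b power_add)
  have c: "?h i + b i + b (Suc i) = ?c i" for i
  proof -
    have "(2::nat) ^ (?h i + b i + b (Suc i)) = 2 ^ ?c i"
      using card_cycles_boundaries[of "int i" j] b[of "Suc i"] z[of i]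
      by (simp add: power_add mult_ac add.commute[of 1])
    then show ?thesis by (rule power_inject_exp[THEN iffD1, rotated]) simp
  qed
  have "boundaries 0 j = {\<lambda>s. 0}"
    unfolding boundaries_def using triv[of "-1"] by (simp add: differential_zero)
  then have "(2::nat) ^ b 0 = 2 ^ 0" using b[of 0] by simp
  then have b0: "b 0 = 0" by (rule power_inject_exp[THEN iffD1, rotated]) simp
  let ?n = "card (crossings D)"
  have "boundaries (int (Suc ?n)) j \<subseteq> chains (int (Suc ?n)) j"
    using boundaries_subset[of "int (Suc ?n)" j] unfolding cycles_def by blast
  also have "\<dots> = {\<lambda>s. 0}" by (rule triv) simp
  finally have "card (boundaries (int (Suc ?n)) j) \<le> card {\<lambda>s :: ('c, 'a) enhanced_state. 0 :: bit}"
    by (intro card_mono) simp_all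
  then have "card (boundaries (int (Suc ?n)) j) \<le> 1" by simp
  then have "(2::nat) ^ b (Suc ?n) \<le> 2 ^ 0" by (simp only: b power_0)
  then have bn: "b (Suc ?n) = 0" by (subst (asm) power_increasing_iff) simp_all
  show ?thesis
    unfolding euler_char_def using alternating_telescope[of ?h b "\<lambda>i. ?h i + b i" ?c ?n] c b0 bn by simp
qed

end


section \<open>The state sum\<close>

context bifurcating_diagram
begin

lemma finite_label_UNIV: "finite (UNIV :: label set)" "UNIV = {Lab1, LabX}"
  using label.exhaust by (auto intro: finite_subset[of _ "{Lab1, LabX}"])

lemma euler_char_eq_sum:
  "euler_char D j = (\<Sum>s | s \<in> enhanced_states D \<and> q_grading D s = j. (-1) ^ card (fst s))"
proof -
  let ?E = "{s \<in> enhanced_states D. q_grading D s = j}"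
  have "(\<Sum>s\<in>?E. (-1) ^ card (fst s) :: int)
      = (\<Sum>i\<in>{..card (crossings D)}. \<Sum>s\<in>{s \<in> ?E. card (fst s) = i}. (-1) ^ card (fst s))"
  proof (rule sum.group[symmetric])
    show "finite ?E" using finite_enhanced_states by simp
    show "(\<lambda>s. card (fst s)) ` ?E \<subseteq> {..card (crossings D)}"
      using card_mono[OF finite_crossings] by (auto simp: enhanced_states_def)
  qed simp
  also have "\<dots> = (\<Sum>i\<in>{..card (crossings D)}. (-1) ^ i * int (card (graded_states (int i) j)))"
  proof (rule sum.cong[OF refl])
    fix i
    have "{s \<in> ?E. card (fst s) = i} = graded_states (int i) j"
      by (auto simp: graded_states_def n_B_def)
    then show "(\<Sum>s\<in>{s \<in> ?E. card (fst s) = i}. (-1) ^ card (fst s)) = (-1) ^ i * int (card (graded_states (int i) j))"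
      by (simp add: graded_states_def n_B_def)
  qed
  finally show ?thesis by (simp add: euler_char_eq)
qed

lemma sum_euler_char:
  fixes q :: complex
  shows "Sum_any (\<lambda>j. q powi j * of_int (euler_char D j))
    = (\<Sum>s\<in>enhanced_states D. (-1) ^ card (fst s) * q powi q_grading D s)"
proof -
  let ?J = "q_grading D ` enhanced_states D"
  let ?t = "\<lambda>s. (-1) ^ card (fst s) * q powi q_grading D s"
  have coeff: "q powi j * of_int (euler_char D j) = (\<Sum>s | s \<in> enhanced_states D \<and> q_grading D s = j. ?t s)" for j
    unfolding euler_char_eq_sum of_int_sum sum_distrib_left by (intro sum.cong) auto
  have "Sum_any (\<lambda>j. q powi j * of_int (euler_char D j)) = (\<Sum>j\<in>?J. q powi j * of_int (euler_char D j))"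
  proof (rule Sum_any.expand_superset)
    show "finite ?J" using finite_enhanced_states by simp
    show "{j. q powi j * of_int (euler_char D j) \<noteq> 0} \<subseteq> ?J"
    proof
      fix j assume "j \<in> {j. q powi j * of_int (euler_char D j) \<noteq> 0}"
      then have "(\<Sum>s | s \<in> enhanced_states D \<and> q_grading D s = j. ?t s) \<noteq> 0" unfolding coeff by simp
      then obtain s where "s \<in> {s. s \<in> enhanced_states D \<and> q_grading D s = j}"
        by (rule sum.not_neutral_contains_not_neutral)
      then show "j \<in> ?J" by auto
    qed
  qed
  also have "\<dots> = (\<Sum>s\<in>enhanced_states D. ?t s)"
    unfolding coeff by (rule sum.image_gen[OF finite_enhanced_states, symmetric])
  finally show ?thesis .
qed

text \<open>
  The labels of the loops are independent, and each loop contributes \<open>q\<close> or \<open>q\<^sup>-\<^sup>1\<close>.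
\<close>

theorem state_sum:
  fixes q :: complex
  assumes "q \<noteq> 0"
  shows "Sum_any (\<lambda>j. q powi j * of_int (euler_char D j))
    = (\<Sum>S\<in>Pow (crossings D). (- q) ^ card S * (q + inverse q) ^ card (loops D S))"
proof -
  have "(\<Sum>s\<in>enhanced_states D. (-1) ^ card (fst s) * q powi q_grading D s)
     = (\<Sum>S\<in>Pow (crossings D). \<Sum>l\<in>loops D S \<rightarrow>\<^sub>E UNIV. (-1) ^ card S * q powi q_grading D (S, l))"
    unfolding enhanced_states_def using finite_crossings finite_labels
    by (subst sum.Sigma) (auto simp: case_prod_unfold)
  also have "\<dots> = (\<Sum>S\<in>Pow (crossings D). (- q) ^ card S * (q + inverse q) ^ card (loops D S))"
  proof (rule sum.cong[OF refl])
    fix S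
    have "q powi q_grading D (S, l) = q ^ card S * (\<Prod>\<gamma>\<in>loops D S. q powi weight (l \<gamma>))" for l
    proof -
      have prod: "q powi (\<Sum>\<gamma>\<in>A. weight (l \<gamma>)) = (\<Prod>\<gamma>\<in>A. q powi weight (l \<gamma>))" if "finite A" for A
        using that by induction (simp_all add: power_int_add assms)
      show ?thesis
        using prod[OF finite_loops] by (simp add: q_grading_def n_B_def label_excess_eq_sum power_int_add assms)
    qed
    then have "(\<Sum>l\<in>loops D S \<rightarrow>\<^sub>E UNIV. (-1) ^ card S * q powi q_grading D (S, l))
        = (- q) ^ card S * (\<Sum>l\<in>loops D S \<rightarrow>\<^sub>E UNIV. \<Prod>\<gamma>\<in>loops D S. q powi weight (l \<gamma>))"
      by (simp add: sum_distrib_left power_minus[of q] mult.assoc)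
    also have "(\<Sum>l\<in>loops D S \<rightarrow>\<^sub>E UNIV. \<Prod>\<gamma>\<in>loops D S. q powi weight (l \<gamma>))
        = (\<Prod>\<gamma>\<in>loops D S. \<Sum>x\<in>UNIV. q powi weight x)"
      by (rule prod_sum_PiE[symmetric]) (use finite_loops finite_label_UNIV in auto)
    also have "\<dots> = (q + inverse q) ^ card (loops D S)"
      unfolding finite_label_UNIV(2) by (simp add: power_int_minus)
    finally show "(\<Sum>l\<in>loops D S \<rightarrow>\<^sub>E UNIV. (-1) ^ card S * q powi q_grading D (S, l))
        = (- q) ^ card S * (q + inverse q) ^ card (loops D S)" .
  qed
  finally show ?thesis unfolding sum_euler_char .
qed

end

section \<open>The Fortuin--Kasteleyn expansion\<close>

definition linked :: "('v, 'e) embedded_graph \<Rightarrow> 'e set \<Rightarrow> ('v \<times> 'v) set" where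
  "linked G S = {(base G d, base G (flip d)) | d. d \<in> darts G \<and> fst d \<in> S}\<^sup>*"

lemma flip_simps [simp]: "flip (flip d) = d" "fst (flip d) = fst d" "flip d \<in> darts G \<longleftrightarrow> d \<in> darts G"
  by (auto simp: flip_def darts_def mem_Times_iff)

lemma equiv_linked: "equiv UNIV (linked G S)"
proof -
  let ?R = "{(base G d, base G (flip d)) | d. d \<in> darts G \<and> fst d \<in> S}"
  have "?R\<inverse> \<subseteq> ?R"
  proof
    fix p assume "p \<in> ?R\<inverse>"
    then obtain d where d: "p = (base G (flip d), base G d)" "d \<in> darts G" "fst d \<in> S" by auto
    then have "p = (base G (flip d), base G (flip (flip d)))" "flip d \<in> darts G" "fst (flip d) \<in> S" by simp_all
    then show "p \<in> ?R" by blast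
  qed
  then have "?R \<union> ?R\<inverse> = ?R" by (rule Un_absorb2)
  then show ?thesis using equiv_symmetric_rtrancl[of ?R] unfolding linked_def by simp
qed

lemma linked_edges: "components G = nodes G // linked G (edges G)"
proof -
  have "{(base G d, base G (flip d)) | d. d \<in> darts G \<and> fst d \<in> edges G} = {(base G d, base G (flip d)) | d. d \<in> darts G}"
    by (auto simp: darts_def)
  then show ?thesis by (simp add: components_def linked_def)
qed

lemma linked_base: "d \<in> darts G \<Longrightarrow> fst d \<in> S \<Longrightarrow> (base G d, base G (flip d)) \<in> linked G S"
  unfolding linked_def by (intro r_into_rtrancl) blast

lemma card_constant_on_classes:
  assumes L: "equiv UNIV L" and N: "finite N" and A: "finite A"
  shows "card {\<sigma> \<in> N \<rightarrow>\<^sub>E A. \<forall>x\<in>N. \<forall>y\<in>N. (x, y) \<in> L \<longrightarrow> \<sigma> x = \<sigma> y} = card A ^ card (N // L)"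
proof -
  have same: "L `` {x} = L `` {y} \<longleftrightarrow> (x, y) \<in> L" for x y by (simp add: eq_equiv_class_iff[OF L])
  define pt where "pt c = (SOME x. x \<in> N \<and> L `` {x} = c)" for c
  have pt: "pt (L `` {x}) \<in> N \<and> (pt (L `` {x}), x) \<in> L" if "x \<in> N" for x
    using that unfolding pt_def same[symmetric] by (rule_tac someI[of "\<lambda>y. y \<in> N \<and> L `` {y} = L `` {x}" x]) simp
  have "bij_betw (\<lambda>\<tau>. \<lambda>x\<in>N. \<tau> (L `` {x})) (N // L \<rightarrow>\<^sub>E A)
      {\<sigma> \<in> N \<rightarrow>\<^sub>E A. \<forall>x\<in>N. \<forall>y\<in>N. (x, y) \<in> L \<longrightarrow> \<sigma> x = \<sigma> y}"
  proof (rule bij_betwI[where g = "\<lambda>\<sigma>. \<lambda>c\<in>N // L. \<sigma> (pt c)"])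
    show "(\<lambda>\<tau>. \<lambda>x\<in>N. \<tau> (L `` {x})) \<in> (N // L \<rightarrow>\<^sub>E A) \<rightarrow> {\<sigma> \<in> N \<rightarrow>\<^sub>E A. \<forall>x\<in>N. \<forall>y\<in>N. (x, y) \<in> L \<longrightarrow> \<sigma> x = \<sigma> y}"
    proof (rule Pi_I)
      fix \<tau> assume t: "\<tau> \<in> N // L \<rightarrow>\<^sub>E A"
      have "(\<lambda>x\<in>N. \<tau> (L `` {x})) \<in> N \<rightarrow>\<^sub>E A"
        by (rule restrict_PiE_iff[THEN iffD2]) (use t in \<open>auto intro: PiE_mem quotientI\<close>)
      moreover have "\<tau> (L `` {x}) = \<tau> (L `` {y})" if "(x, y) \<in> L" for x y
        using that same[of x y] by simp
      ultimately show "(\<lambda>x\<in>N. \<tau> (L `` {x})) \<in> {\<sigma> \<in> N \<rightarrow>\<^sub>E A. \<forall>x\<in>N. \<forall>y\<in>N. (x, y) \<in> L \<longrightarrow> \<sigma> x = \<sigma> y}"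
        by simp
    qed
    show "(\<lambda>\<sigma>. \<lambda>c\<in>N // L. \<sigma> (pt c)) \<in> {\<sigma> \<in> N \<rightarrow>\<^sub>E A. \<forall>x\<in>N. \<forall>y\<in>N. (x, y) \<in> L \<longrightarrow> \<sigma> x = \<sigma> y} \<rightarrow> (N // L \<rightarrow>\<^sub>E A)"
    proof (rule Pi_I, unfold restrict_PiE_iff, rule ballI)
      fix \<sigma> c
      assume s: "\<sigma> \<in> {\<sigma> \<in> N \<rightarrow>\<^sub>E A. \<forall>x\<in>N. \<forall>y\<in>N. (x, y) \<in> L \<longrightarrow> \<sigma> x = \<sigma> y}" and "c \<in> N // L"
      then obtain x where "x \<in> N" "c = L `` {x}" by (auto elim: quotientE)
      then show "\<sigma> (pt c) \<in> A" using pt[of x] s by (auto intro: PiE_mem)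
    qed
  next
    fix \<tau> assume t: "\<tau> \<in> N // L \<rightarrow>\<^sub>E A"
    show "(\<lambda>c\<in>N // L. (\<lambda>x\<in>N. \<tau> (L `` {x})) (pt c)) = \<tau>"
    proof (rule PiE_ext[OF _ t])
      show "(\<lambda>c\<in>N // L. (\<lambda>x\<in>N. \<tau> (L `` {x})) (pt c)) \<in> N // L \<rightarrow>\<^sub>E A"
        unfolding restrict_PiE_iff
      proof
        fix c assume "c \<in> N // L"
        then obtain x where x: "x \<in> N" "c = L `` {x}" by (rule quotientE)
        then show "(\<lambda>x\<in>N. \<tau> (L `` {x})) (pt c) \<in> A"
          using pt[of x] PiE_mem[OF t quotientI[of "pt c" N L]] by simp
      qed
      fix c assume "c \<in> N // L"
      then obtain x where x: "x \<in> N" "c = L `` {x}" by (rule quotientE)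
      then have "L `` {pt c} = c" using pt[of x] same by simp
      then show "(\<lambda>c\<in>N // L. (\<lambda>x\<in>N. \<tau> (L `` {x})) (pt c)) c = \<tau> c"
        using pt[of x] x \<open>c \<in> N // L\<close> by simp
    qed
  next
    fix \<sigma> assume s: "\<sigma> \<in> {\<sigma> \<in> N \<rightarrow>\<^sub>E A. \<forall>x\<in>N. \<forall>y\<in>N. (x, y) \<in> L \<longrightarrow> \<sigma> x = \<sigma> y}"
    have "(\<lambda>x\<in>N. (\<lambda>c\<in>N // L. \<sigma> (pt c)) (L `` {x})) x = \<sigma> x" for x
    proof (cases "x \<in> N")
      case True
      then show ?thesis using s pt[OF True] quotientI[OF True, of L] by simp
    next
      case False
      then show ?thesis using s by (auto simp: PiE_def extensional_def)
    qed
    then show "(\<lambda>x\<in>N. (\<lambda>c\<in>N // L. \<sigma> (pt c)) (L `` {x})) = \<sigma>" by (rule ext)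
  qed
  then have "card {\<sigma> \<in> N \<rightarrow>\<^sub>E A. \<forall>x\<in>N. \<forall>y\<in>N. (x, y) \<in> L \<longrightarrow> \<sigma> x = \<sigma> y} = card (N // L \<rightarrow>\<^sub>E A)"
    by (rule bij_betw_same_card[symmetric])
  also have "\<dots> = card A ^ card (N // L)"
    using N by (subst card_PiE) (auto simp: quotient_def)
  finally show ?thesis .
qed

lemma constant_on_edges_iff:
  assumes base: "base G \<in> darts G \<rightarrow> nodes G" and S: "S \<subseteq> edges G"
  shows "(\<forall>e\<in>S. \<sigma> (base G (e, True)) = \<sigma> (base G (e, False))) \<longleftrightarrow>
    (\<forall>x\<in>nodes G. \<forall>y\<in>nodes G. (x, y) \<in> linked G S \<longrightarrow> \<sigma> x = \<sigma> y)"
proof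
  assume const: "\<forall>e\<in>S. \<sigma> (base G (e, True)) = \<sigma> (base G (e, False))"
  have "\<sigma> x = \<sigma> y" if "(x, y) \<in> linked G S" for x y
    using that unfolding linked_def
  proof induction
    case (step y z)
    then obtain d where d: "y = base G d" "z = base G (flip d)" "fst d \<in> S" by auto
    have "\<sigma> (base G d) = \<sigma> (base G (flip d))"
      using const d(3) by (cases d; cases "snd d") (auto simp: flip_def)
    then show ?case using step.IH d by simp
  qed simp
  then show "\<forall>x\<in>nodes G. \<forall>y\<in>nodes G. (x, y) \<in> linked G S \<longrightarrow> \<sigma> x = \<sigma> y" by blast
next
  assume const: "\<forall>x\<in>nodes G. \<forall>y\<in>nodes G. (x, y) \<in> linked G S \<longrightarrow> \<sigma> x = \<sigma> y"
  show "\<forall>e\<in>S. \<sigma> (base G (e, True)) = \<sigma> (base G (e, False))"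
  proof
    fix e assume "e \<in> S"
    then have d: "(e, True) \<in> darts G" "(e, False) \<in> darts G" using S by (auto simp: darts_def)
    have "base G (e, True) \<in> nodes G" "base G (e, False) \<in> nodes G" using base d by blast+
    moreover have "(base G (e, True), base G (e, False)) \<in> linked G S"
      using linked_base[OF d(1), of S] \<open>e \<in> S\<close> by (simp add: flip_def)
    ultimately show "\<sigma> (base G (e, True)) = \<sigma> (base G (e, False))" using const by blast
  qed
qed

text \<open>
  An edge contributes \<open>1 + (e\<^bsup>it/hbar\<^esup> - 1) \<delta>\<close>, where \<open>\<delta>\<close> tells whether its ends agree. Expanding
  the product over all edges selects a set \<open>S\<close> of edges, and the assignments that survive are those
  constant on the components of the spanning subgraph \<open>S\<close>.
\<close>

theorem fortuin_kasteleyn: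
  assumes fin: "finite (nodes G)" "finite (edges G)" and base: "base G \<in> darts G \<rightarrow> nodes G"
  shows "potts_amplitude G hbar Q t = (\<Sum>S\<in>Pow (edges G).
    (exp (\<i> * complex_of_real (t / hbar)) - 1) ^ card S * of_nat Q ^ card (nodes G // linked G S))"
proof -
  let ?w = "exp (\<i> * complex_of_real (t / hbar))"
  let ?\<Sigma> = "nodes G \<rightarrow>\<^sub>E {1..Q}"
  let ?eq = "\<lambda>\<sigma> e. \<sigma> (base G (e, True)) = \<sigma> (base G (e, False))"
  have "exp (\<i> * complex_of_real (t / hbar) * of_nat (energy G \<sigma>))
      = (\<Sum>S\<in>Pow (edges G). (?w - 1) ^ card S * of_bool (\<forall>e\<in>S. ?eq \<sigma> e))" for \<sigma> :: "'a \<Rightarrow> nat"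
  proof -
    have "exp (\<i> * complex_of_real (t / hbar) * of_nat (energy G \<sigma>)) = ?w ^ energy G \<sigma>"
      by (rule exp_of_nat2_mult)
    also have "\<dots> = (\<Prod>e\<in>edges G. if ?eq \<sigma> e then ?w else 1)"
      using fin(2) by (simp add: energy_def prod.If_cases Int_def)
    also have "\<dots> = (\<Prod>e\<in>edges G. (?w - 1) * of_bool (?eq \<sigma> e) + 1)"
      by (intro prod.cong) auto
    also have "\<dots> = (\<Sum>S\<in>Pow (edges G). \<Prod>e\<in>S. (?w - 1) * of_bool (?eq \<sigma> e))"
      using prod_add[OF fin(2), of "\<lambda>e. (?w - 1) * of_bool (?eq \<sigma> e)" "\<lambda>_. 1"] by simp
    also have "\<dots> = (\<Sum>S\<in>Pow (edges G). (?w - 1) ^ card S * of_bool (\<forall>e\<in>S. ?eq \<sigma> e))"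
    proof (rule sum.cong[OF refl])
      fix S assume "S \<in> Pow (edges G)"
      then have "finite S" using fin(2) finite_subset by auto
      then have "(\<Prod>e\<in>S. of_bool (?eq \<sigma> e)) = (of_bool (\<forall>e\<in>S. ?eq \<sigma> e) :: complex)"
        by induction auto
      then show "(\<Prod>e\<in>S. (?w - 1) * of_bool (?eq \<sigma> e)) = (?w - 1) ^ card S * of_bool (\<forall>e\<in>S. ?eq \<sigma> e)"
        by (simp add: prod.distrib)
    qed
    finally show ?thesis .
  qed
  then have "potts_amplitude G hbar Q t
      = (\<Sum>\<sigma>\<in>?\<Sigma>. \<Sum>S\<in>Pow (edges G). (?w - 1) ^ card S * of_bool (\<forall>e\<in>S. ?eq \<sigma> e))"
    by (simp add: potts_amplitude_def)
  also have "\<dots> = (\<Sum>S\<in>Pow (edges G). \<Sum>\<sigma>\<in>?\<Sigma>. (?w - 1) ^ card S * of_bool (\<forall>e\<in>S. ?eq \<sigma> e))"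
    by (rule sum.swap)
  also have "\<dots> = (\<Sum>S\<in>Pow (edges G). (?w - 1) ^ card S * of_nat Q ^ card (nodes G // linked G S))"
  proof (rule sum.cong[OF refl])
    fix S assume S: "S \<in> Pow (edges G)"
    have finS: "finite ?\<Sigma>" using fin(1) by (intro finite_PiE) auto
    have "(\<Sum>\<sigma>\<in>?\<Sigma>. of_bool (\<forall>e\<in>S. ?eq \<sigma> e)) = (of_nat (card {\<sigma> \<in> ?\<Sigma>. \<forall>e\<in>S. ?eq \<sigma> e}) :: complex)"
      using finS by (simp add: sum_of_bool_eq Int_def)
    also have "{\<sigma> \<in> ?\<Sigma>. \<forall>e\<in>S. ?eq \<sigma> e}
        = {\<sigma> \<in> ?\<Sigma>. \<forall>x\<in>nodes G. \<forall>y\<in>nodes G. (x, y) \<in> linked G S \<longrightarrow> \<sigma> x = \<sigma> y}"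
      using constant_on_edges_iff[OF base] S by auto
    also have "card \<dots> = Q ^ card (nodes G // linked G S)"
      using card_constant_on_classes[OF equiv_linked fin(1), of "{1..Q}" G S] by simp
    finally show "(\<Sum>\<sigma>\<in>?\<Sigma>. (?w - 1) ^ card S * of_bool (\<forall>e\<in>S. ?eq \<sigma> e))
        = (?w - 1) ^ card S * of_nat Q ^ card (nodes G // linked G S)"
      by (simp add: sum_distrib_left[symmetric])
  qed
  finally show ?thesis .
qed


section \<open>Boundary curves in a plane graph\<close>

text \<open>
  The boundary of a regular neighbourhood of the spanning subgraph \<open>S\<close> passes from one corner to
  the next: along an edge of \<open>S\<close> to its other end, past any other edge around the same node. For
  \<open>S = {}\<close> this is the rotation, for the set of all edges it is the step of the face walks.
\<close>

definition boundary_step :: "('v, 'e) embedded_graph \<Rightarrow> 'e set \<Rightarrow> 'e \<times> bool \<Rightarrow> 'e \<times> bool" where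
  "boundary_step G S d = rot G (if fst d \<in> S then flip d else d)"

locale plane_graph_medial =
  fixes G :: "('v, 'e) embedded_graph"
  assumes plane: "plane_graph G"
begin

abbreviation "D \<equiv> medial_diagram G"

lemma finite_nodes: "finite (nodes G)" and finite_edges: "finite (edges G)"
  and base_in: "d \<in> darts G \<Longrightarrow> base G d \<in> nodes G"
  and rot_permutes: "rot G permutes darts G"
  and orbit_rot: "d \<in> darts G \<Longrightarrow> orbit (rot G) d = {d' \<in> darts G. base G d' = base G d}"
  and euler: "card (nodes G) + (card (face_walks G) + card (isolated_nodes G))
       = card (edges G) + 2 * card (components G)"
  using plane unfolding plane_graph_def by blast+

lemma finite_darts: "finite (darts G)"
  using finite_edges by (simp add: darts_def)

lemma rot_in: "rot G d \<in> darts G \<longleftrightarrow> d \<in> darts G"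
  using permutes_in_image[OF rot_permutes] .

lemma base_rot: "d \<in> darts G \<Longrightarrow> base G (rot G d) = base G d"
  using orbit.base[of "rot G" d] orbit_rot[of d] by simp

lemma medial_simps: "crossings D = edges G" "circles D = Inr ` isolated_nodes G"
  "pd D e = (Inl (rot G (e, True)), Inl (e, True), Inl (rot G (e, False)), Inl (e, False))"
  "end0 D e = Inl (rot G (e, True))" "end2 D e = Inl (rot G (e, False))"
  by (simp_all add: medial_diagram_def end0_def end2_def)

lemma dart_cases: "d \<in> darts G \<longleftrightarrow> (\<exists>e\<in>edges G. d = (e, True) \<or> d = (e, False))"
proof -
  obtain e b where "d = (e, b)" by (cases d)
  then show ?thesis by (cases b) (auto simp: darts_def)
qed

lemma medial_arcs: "diagram_arcs D = Inl ` darts G \<union> Inr ` isolated_nodes G"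
proof -
  have arcs: "arcs_at D e = Inl ` ({(e, True), (e, False)} \<union> rot G ` {(e, True), (e, False)})" for e
    unfolding arcs_at_def medial_simps by auto
  have "darts G = (\<Union>e\<in>edges G. {(e, True), (e, False)})" using dart_cases by auto
  then have "(\<Union>e\<in>edges G. arcs_at D e) = Inl ` (darts G \<union> rot G ` darts G)"
    unfolding arcs by (simp only: image_UN image_Un UN_Un_distrib)
  moreover have "rot G ` darts G = darts G" by (rule permutes_image[OF rot_permutes])
  ultimately show ?thesis by (simp add: diagram_arcs_def medial_simps)
qed

lemma boundary_step_permutes: "S \<subseteq> edges G \<Longrightarrow> boundary_step G S permutes darts G"
proof -
  assume S: "S \<subseteq> edges G"
  let ?f = "\<lambda>d. if fst d \<in> S then flip d else d"
  have "?f permutes darts G"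
  proof (rule bij_imp_permutes)
    show "bij_betw ?f (darts G) (darts G)"
      by (rule bij_betwI[where g = ?f]) auto
    fix d assume "d \<notin> darts G"
    then show "?f d = d" using S by (cases d) (auto simp: darts_def)
  qed
  from permutes_compose[OF this rot_permutes]
  show ?thesis by (simp add: boundary_step_def[abs_def] comp_def)
qed

lemma boundary_step_in:
  "S \<subseteq> edges G \<Longrightarrow> boundary_step G S d \<in> darts G \<longleftrightarrow> d \<in> darts G"
  using permutes_in_image[OF boundary_step_permutes] .

lemma boundary_step_permutation: "S \<subseteq> edges G \<Longrightarrow> permutation (boundary_step G S)"
  using boundary_step_permutes finite_darts permutation_permutes by blast

lemma joins_boundary_step:
  "(if e \<in> S then B_joins D e else A_joins D e) =
    (if e \<in> S then {(Inl (e, True), Inl (boundary_step G S (e, True))), (Inl (e, False), Inl (boundary_step G S (e, False)))}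
     else {(Inl (boundary_step G S (e, True)), Inl (e, True)), (Inl (boundary_step G S (e, False)), Inl (e, False))})"
  by (simp add: A_joins_def B_joins_def medial_simps boundary_step_def flip_def)

lemma same_loop_boundary_step:
  assumes "d \<in> darts G"
  shows "(Inl d, Inl (boundary_step G S d)) \<in> same_loop D S"
proof -
  obtain e b where d: "d = (e, b)" by (cases d)
  then have e: "e \<in> crossings D" using assms by (simp add: darts_def medial_simps)
  show ?thesis
  proof (cases "e \<in> S")
    case True
    then show ?thesis using same_loop_join[OF e, of _ _ S] unfolding joins_boundary_step d
      by (cases b) auto
  next
    case False
    then have "(Inl (boundary_step G S d), Inl d) \<in> same_loop D S"
      using same_loop_join[OF e, of _ _ S] unfolding joins_boundary_step d by (cases b) auto
    then show ?thesis by (rule same_loop_sym)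
  qed
qed

lemma same_loop_medial_least:
  assumes F: "equiv UNIV F" and step: "\<And>d. d \<in> darts G \<Longrightarrow> (Inl d, Inl (boundary_step G S d)) \<in> F"
  shows "same_loop D S \<subseteq> F"
proof (rule same_loop_least[OF F])
  fix e assume "e \<in> crossings D"
  then have "(e, True) \<in> darts G" "(e, False) \<in> darts G" by (simp_all add: darts_def medial_simps)
  from step[OF this(1)] step[OF this(2)]
  have "(Inl (e, True), Inl (boundary_step G S (e, True))) \<in> F" "(Inl (e, False), Inl (boundary_step G S (e, False))) \<in> F" .
  moreover from this have "(Inl (boundary_step G S (e, True)), Inl (e, True)) \<in> F" "(Inl (boundary_step G S (e, False)), Inl (e, False)) \<in> F"
    using F unfolding equiv_def by (simp_all add: symD)
  ultimately show "(if e \<in> S then B_joins D e else A_joins D e) \<subseteq> F"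
    unfolding joins_boundary_step by simp
qed

text \<open>
  The loop through an arc is the cycle of \<open>boundary_step\<close> through its dart. The closure under inverse
  steps that \<open>same_loop\<close> takes adds nothing, because the darts are finite in number.
\<close>

lemma same_loop_medial:
  assumes S: "S \<subseteq> edges G"
  shows "same_loop D S = {(Inl d, Inl d') | d d'. d \<in> darts G \<and> d' \<in> orbit (boundary_step G S) d} \<union> Id" (is "_ = ?F")
proof
  let ?p = "boundary_step G S"
  note perm = boundary_step_permutation[OF S]
  have orbit_in: "d' \<in> orbit ?p d \<Longrightarrow> d \<in> darts G \<Longrightarrow> d' \<in> darts G" for d d'
    by (induction rule: orbit.induct) (simp_all add: boundary_step_in[OF S])
  have "equiv UNIV ?F"
  proof (rule equivI)
    show "refl ?F" by (auto simp: refl_on_def)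
    show "sym ?F"
    proof (rule symI)
      fix x y assume "(x, y) \<in> ?F"
      then consider "x = y" | d d' where "x = Inl d" "y = Inl d'" "d \<in> darts G" "d' \<in> orbit ?p d" by blast
      then show "(y, x) \<in> ?F"
      proof cases
        case 2
        then have "d \<in> orbit ?p d'" "d' \<in> darts G"
          using orbit_swap[OF permutation_self_in_orbit[OF perm]] orbit_in by auto
        then show ?thesis using 2 by blast
      qed simp
    qed
    show "trans ?F"
    proof (rule transI)
      fix x y z assume "(x, y) \<in> ?F" "(y, z) \<in> ?F"
      then consider "x = y" | "y = z"
        | d d' d'' where "x = Inl d" "y = Inl d'" "z = Inl d''" "d \<in> darts G" "d' \<in> orbit ?p d" "d'' \<in> orbit ?p d'"
        by auto
      then show "(x, z) \<in> ?F"
      proof cases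
        case 3
        have "d'' \<in> orbit ?p d" by (rule orbit_trans[OF 3(6,5)])
        then show ?thesis using 3 by blast
      qed (use \<open>(x, y) \<in> ?F\<close> \<open>(y, z) \<in> ?F\<close> in simp_all)
    qed
  qed simp
  then show "same_loop D S \<subseteq> ?F"
    by (rule same_loop_medial_least) (blast intro: orbit.base)
  have "(Inl d, Inl d') \<in> same_loop D S" if "d' \<in> orbit ?p d" "d \<in> darts G" for d d'
    using that
  proof (induction rule: orbit.induct)
    case base
    then show ?case by (rule same_loop_boundary_step)
  next
    case (step x)
    show ?case
      by (rule same_loop_trans[OF step.IH[OF step.prems] same_loop_boundary_step[OF orbit_in[OF step.hyps step.prems]]])
  qed
  then show "?F \<subseteq> same_loop D S" by auto
qed

lemma card_loops_medial:
  assumes S: "S \<subseteq> edges G"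
  shows "card (loops D S) = card (orbit (boundary_step G S) ` darts G) + card (isolated_nodes G)"
proof -
  let ?p = "boundary_step G S"
  have loop_dart: "loop_of D S (Inl d) = Inl ` orbit ?p d" if "d \<in> darts G" for d
  proof (rule Set.set_eqI)
    fix y
    show "y \<in> loop_of D S (Inl d) \<longleftrightarrow> y \<in> Inl ` orbit ?p d"
      unfolding mem_loop_of same_loop_medial[OF S]
      using that permutation_self_in_orbit[OF boundary_step_permutation[OF S], of d] by blast
  qed
  have loop_node: "loop_of D S (Inr v) = {Inr v}" for v
    unfolding loop_of_def same_loop_medial[OF S] by auto
  have "loops D S = loop_of D S ` (Inl ` darts G) \<union> loop_of D S ` (Inr ` isolated_nodes G)"
    unfolding loops_eq_image medial_arcs by (rule image_Un)
  also have "loop_of D S ` (Inl ` darts G) = image Inl ` (orbit ?p ` darts G)"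
    using loop_dart by (simp add: image_image)
  also have "loop_of D S ` (Inr ` isolated_nodes G) = (\<lambda>v. {Inr v}) ` isolated_nodes G"
    by (simp add: image_image loop_node)
  finally have eq: "loops D S = image Inl ` (orbit ?p ` darts G) \<union> (\<lambda>v. {Inr v}) ` isolated_nodes G" .
  have iso: "finite (isolated_nodes G)" using finite_nodes by (simp add: isolated_nodes_def)
  have "card (image Inl ` (orbit ?p ` darts G) :: (('e \<times> bool) + 'v) set set) = card (orbit ?p ` darts G)"
    by (rule card_image) (auto intro!: inj_onI simp: inj_image_eq_iff)
  moreover have "card ((\<lambda>v. {Inr v}) ` isolated_nodes G :: (('e \<times> bool) + 'v) set set) = card (isolated_nodes G)"
    by (rule card_image) (auto intro: inj_onI)
  moreover have "image Inl ` (orbit ?p ` darts G) \<inter> (\<lambda>v. {Inr v}) ` isolated_nodes G = ({} :: (('e \<times> bool) + 'v) set set)"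
    using orbit_nonempty by auto
  ultimately show ?thesis
    unfolding eq using finite_darts iso by (subst card_Un_disjoint) auto
qed

lemma loops_none: "card (loops D {}) = card (nodes G)"
proof -
  have "boundary_step G {} = rot G" by (simp add: boundary_step_def fun_eq_iff)
  then have "orbit (boundary_step G {}) ` darts G = (\<lambda>v. {d \<in> darts G. base G d = v}) ` (base G ` darts G)"
    using orbit_rot by (simp add: image_image)
  moreover have "inj_on (\<lambda>v. {d \<in> darts G. base G d = v}) (base G ` darts G)"
    by (rule inj_onI) blast
  ultimately have "card (orbit (boundary_step G {}) ` darts G) = card (base G ` darts G)"
    by (simp add: card_image)
  moreover have "base G ` darts G \<subseteq> nodes G" using base_in by blast
  then have "card (nodes G) = card (base G ` darts G) + card (isolated_nodes G)"
    unfolding isolated_nodes_def using finite_nodes finite_darts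
    by (simp add: card_Diff_subset card_mono)
  ultimately show ?thesis using card_loops_medial[of "{}"] by simp
qed

lemma loops_all: "card (loops D (edges G)) = card (face_walks G) + card (isolated_nodes G)"
proof -
  have "orbit (boundary_step G (edges G)) d = orbit (rot G \<circ> flip) d" if d: "d \<in> darts G" for d
  proof (rule orbit_cong0[of d "darts G"])
    show "boundary_step G (edges G) \<in> darts G \<rightarrow> darts G" by (simp add: boundary_step_in)
    fix x assume "x \<in> darts G"
    then show "boundary_step G (edges G) x = (rot G \<circ> flip) x" by (auto simp: boundary_step_def darts_def)
  qed (rule d)
  then have "orbit (boundary_step G (edges G)) ` darts G = face_walks G"
    unfolding face_walks_def by auto
  then show ?thesis using card_loops_medial[of "edges G"] by simp
qed

lemma same_loop_linked:
  assumes "S \<subseteq> edges G" "(Inl d, Inl d') \<in> same_loop D S" "d \<in> darts G"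
  shows "(base G d, base G d') \<in> linked G S"
proof -
  have L: "(x, x) \<in> linked G S" "(x, y) \<in> linked G S \<Longrightarrow> (y, z) \<in> linked G S \<Longrightarrow> (x, z) \<in> linked G S" for x y z
    by (auto simp: linked_def)
  have step: "(base G x, base G (boundary_step G S x)) \<in> linked G S" if "x \<in> darts G" for x
  proof (cases "fst x \<in> S")
    case True
    then show ?thesis using linked_base[OF that] base_rot[of "flip x"] that by (simp add: boundary_step_def)
  next
    case False
    then show ?thesis using base_rot[OF that] L(1) by (simp add: boundary_step_def)
  qed
  have "d' \<in> darts G \<and> (base G d, base G d') \<in> linked G S" if "d' \<in> orbit (boundary_step G S) d" for d'
    using that
  proof (induction rule: orbit.induct)
    case base
    show ?case using step[OF assms(3)] assms(3) boundary_step_in[OF assms(1)] by simp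
  next
    case (step x)
    then show ?case using \<open>\<And>x. x \<in> darts G \<Longrightarrow> (base G x, base G (boundary_step G S x)) \<in> linked G S\<close>[of x] L(2)
      boundary_step_in[OF assms(1)] by blast
  qed
  then show ?thesis using assms(2) L(1) unfolding same_loop_medial[OF assms(1)] by auto
qed

text \<open>
  Adding the edge \<open>e\<close> exchanges the successors of its two darts. The walk from the first dart now
  enters the cycle of the second dart, and follows it up to that dart: the only other
  place where it could leave is the first dart, which lies on a different cycle.
\<close>

lemma boundary_curves_merge:
  assumes S: "S \<subseteq> edges G" "e \<in> edges G - S"
    and apart: "(Inl (e, True), Inl (e, False)) \<notin> same_loop D S"
  shows "(Inl (e, True), Inl (e, False)) \<in> same_loop D (insert e S)"
proof -
  let ?a = "(e, True)" and ?b = "(e, False)"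
  let ?p = "boundary_step G S" and ?p' = "boundary_step G (insert e S)"
  have ab: "?a \<in> darts G" "?b \<in> darts G" using S(2) by (auto simp: darts_def)
  have p': "?p' ?a = ?p ?b" "\<And>x. x \<noteq> ?a \<Longrightarrow> x \<noteq> ?b \<Longrightarrow> ?p' x = ?p x"
    using S(2) by (auto simp: boundary_step_def flip_def prod_eq_iff)
  have first: "(Inl ?a, Inl (?p ?b)) \<in> same_loop D (insert e S)"
    using same_loop_boundary_step[OF ab(1), of "insert e S"] p'(1) by simp
  have "(Inl ?a, Inl x) \<in> same_loop D (insert e S)" if "x \<in> orbit ?p ?b" for x
    using that
  proof (induction rule: orbit.induct)
    case base
    show ?case by (rule first)
  next
    case (step x)
    have x: "(Inl ?b, Inl x) \<in> same_loop D S" using step.hyps ab(2) unfolding same_loop_medial[OF S(1)] by blast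
    show ?case
    proof (cases "x = ?b")
      case True
      then show ?thesis using first by simp
    next
      case False
      have "x \<noteq> ?a" using same_loop_sym[OF x] apart by auto
      then have "?p' x = ?p x" using False by (rule p'(2))
      moreover have "x \<in> darts G"
        using same_loop_closed[OF x] ab(2) by (auto simp: medial_arcs)
      ultimately have "(Inl x, Inl (?p x)) \<in> same_loop D (insert e S)"
        using same_loop_boundary_step[of x "insert e S"] by simp
      then show ?thesis by (rule same_loop_trans[OF step.IH])
    qed
  qed
  then show ?thesis using permutation_self_in_orbit[OF boundary_step_permutation[OF S(1)]] by blast
qed

lemma ends_medial:
  assumes "S \<subseteq> edges G" "e \<in> edges G"
  shows "(end0 D e, end2 D e) \<in> same_loop D S \<longleftrightarrow> (Inl (e, True), Inl (e, False)) \<in> same_loop D S"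
proof -
  have d: "(e, True) \<in> darts G" "(e, False) \<in> darts G" using assms(2) by (auto simp: darts_def)
  note st = same_loop_boundary_step[OF d(1), of S] same_loop_boundary_step[OF d(2), of S]
  show ?thesis
  proof (cases "e \<in> S")
    case True
    then have "(Inl (e, True), end2 D e) \<in> same_loop D S" "(Inl (e, False), end0 D e) \<in> same_loop D S"
      using st by (simp_all add: boundary_step_def flip_def medial_simps)
    then show ?thesis using same_loop_trans same_loop_sym by metis
  next
    case False
    then have "(Inl (e, True), end0 D e) \<in> same_loop D S" "(Inl (e, False), end2 D e) \<in> same_loop D S"
      using st by (simp_all add: boundary_step_def flip_def medial_simps)
    then show ?thesis using same_loop_trans same_loop_sym by metis
  qed
qed

lemma linked_insert:
  assumes e: "e \<in> edges G - S"
  shows "linked G (insert e S) = join_rel (linked G S) (base G (e, True)) (base G (e, False))"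
proof
  let ?J = "join_rel (linked G S) (base G (e, True)) (base G (e, False))"
  have J: "equiv UNIV ?J" by (rule equiv_join_rel[OF equiv_linked])
  have J_refl: "(x, x) \<in> ?J" and J_sym: "(x, y) \<in> ?J \<Longrightarrow> (y, x) \<in> ?J"
    and J_trans: "(x, y) \<in> ?J \<Longrightarrow> (y, z) \<in> ?J \<Longrightarrow> (x, z) \<in> ?J" for x y z
    using J unfolding equiv_def by (simp_all add: refl_on_def symD, metis transD)
  show "linked G (insert e S) \<subseteq> ?J"
  proof
    fix z assume "z \<in> linked G (insert e S)"
    then obtain x y where z: "z = (x, y)" "(x, y) \<in> linked G (insert e S)" by (cases z) auto
    have "(x, y) \<in> ?J"
      using z(2) unfolding linked_def[of G "insert e S"]
    proof induction
      case base
      show ?case by (rule J_refl)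
    next
      case (step y z)
      then obtain d where d: "y = base G d" "z = base G (flip d)" "d \<in> darts G" "fst d = e \<or> fst d \<in> S" by auto
      have "(y, z) \<in> ?J"
      proof (cases "fst d \<in> S")
        case True
        then show ?thesis using linked_base[OF d(3) True] d(1,2) by (simp add: join_rel_def)
      next
        case False
        then have "d = (e, True) \<or> d = (e, False)" using d(4) by (cases d) auto
        then have "y = base G (e, True) \<and> z = base G (e, False) \<or> y = base G (e, False) \<and> z = base G (e, True)"
          using d(1,2) by (elim disjE) (simp_all add: flip_def)
        then show ?thesis using join_rel_pair[OF equiv_linked] J_sym by metis
      qed
      then show ?case using step.IH J_trans by blast
    qed
    then show "z \<in> ?J" using z(1) by simp
  qed
  show "?J \<subseteq> linked G (insert e S)"
  proof (rule join_rel_least[OF equiv_linked])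
    show "linked G S \<subseteq> linked G (insert e S)"
      unfolding linked_def by (rule rtrancl_mono) blast
    have "(e, True) \<in> darts G" using e by (simp add: darts_def)
    from linked_base[OF this, of "insert e S"]
    show "(base G (e, True), base G (e, False)) \<in> linked G (insert e S)" by (simp add: flip_def)
  qed
qed

text \<open>
  Twice the total genus of the surface obtained by capping off the boundary curves of a
  neighbourhood of the spanning subgraph \<open>S\<close>.
\<close>

definition defect :: "'e set \<Rightarrow> int" where
  "defect S = 2 * int (card (nodes G // linked G S)) + int (card S) - int (card (nodes G)) - int (card (loops D S))"

text \<open>
  An edge between different components also joins different boundary curves, and both counts drop by
  one. An edge inside a component leaves the components as they are, and changes the number of
  curves by at most one.
\<close>

lemma defect_step:
  assumes S: "S \<subseteq> edges G" "e \<in> edges G - S"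
  shows "(base G (e, True), base G (e, False)) \<notin> linked G S \<Longrightarrow>
      (end0 D e, end2 D e) \<notin> same_loop D S \<and> (end0 D e, end2 D e) \<in> same_loop D (insert e S)"
    "defect (insert e S) - defect S = (if (base G (e, True), base G (e, False)) \<in> linked G S
      then 1 + of_bool ((end0 D e, end2 D e) \<notin> same_loop D S) - of_bool ((end0 D e, end2 D e) \<notin> same_loop D (insert e S))
      else 0)"
proof -
  let ?x = "end0 D e" and ?y = "end2 D e" and ?S' = "insert e S"
  have S': "?S' \<subseteq> edges G" and e: "e \<in> edges G" using S by auto
  have d: "(e, True) \<in> darts G" "(e, False) \<in> darts G" using e by (auto simp: darts_def)
  show apart: "(?x, ?y) \<notin> same_loop D S \<and> (?x, ?y) \<in> same_loop D ?S'"
    if "(base G (e, True), base G (e, False)) \<notin> linked G S"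
    unfolding ends_medial[OF S(1) e] ends_medial[OF S' e]
    using that same_loop_linked[OF S(1) _ d(1)] boundary_curves_merge[OF S] by blast
  have fin: "finite (diagram_arcs D)"
    using finite_darts finite_nodes by (simp add: medial_arcs isolated_nodes_def)
  have "e \<in> crossings D" using e by (simp add: medial_simps)
  note ends = ends_in_arcs[OF this]
  have loops: "card (loops D S) + of_bool ((?x, ?y) \<notin> same_loop D ?S') = card (loops D ?S') + of_bool ((?x, ?y) \<notin> same_loop D S)"
    using card_quotient_join_rel[OF equiv_same_loop fin ends, of D S]
      card_quotient_join_rel[OF equiv_same_loop fin ends, of D ?S']
      join_same_loop_eq[OF \<open>e \<in> crossings D\<close>, of S] S(2) unfolding loops_def by simp
  have nodes: "card (nodes G // linked G ?S') + of_bool ((base G (e, True), base G (e, False)) \<notin> linked G S)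
      = card (nodes G // linked G S)"
    unfolding linked_insert[OF S(2)]
    by (rule card_quotient_join_rel[OF equiv_linked finite_nodes base_in[OF d(1)] base_in[OF d(2)]])
  have "finite S" using S(1) finite_edges by (rule finite_subset)
  then have "card ?S' = card S + 1" using S(2) by simp
  then show "defect ?S' - defect S = (if (base G (e, True), base G (e, False)) \<in> linked G S
      then 1 + of_bool ((?x, ?y) \<notin> same_loop D S) - of_bool ((?x, ?y) \<notin> same_loop D ?S')
      else 0)"
    using loops nodes apart unfolding defect_def
    by (cases "(base G (e, True), base G (e, False)) \<in> linked G S";
        cases "(?x, ?y) \<in> same_loop D S"; cases "(?x, ?y) \<in> same_loop D ?S'") simp_all
qed

lemma defect_mono:
  assumes "S \<subseteq> T" "T \<subseteq> edges G"
  shows "defect S \<le> defect T"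
proof -
  have add: "defect S \<le> defect (S \<union> F)" if "finite F" "F \<subseteq> edges G - S" for F
    using that
  proof (induction F rule: finite_induct)
    case (insert e F)
    have "S \<union> F \<subseteq> edges G" "e \<in> edges G - (S \<union> F)"
      using insert.prems insert.hyps assms by auto
    from defect_step(2)[OF this] have "defect (S \<union> F) \<le> defect (insert e (S \<union> F))"
      by (simp add: of_bool_def split: if_splits)
    moreover have "defect S \<le> defect (S \<union> F)" using insert.IH insert.prems by simp
    ultimately show ?case by simp
  qed simp
  have "finite (T - S)" using assms(2) finite_edges by (meson finite_Diff finite_subset)
  moreover have "T - S \<subseteq> edges G - S" using assms(2) by blast
  moreover have "S \<union> (T - S) = T" using assms(1) by blast
  ultimately show ?thesis using add[of "T - S"] by simp
qed

text \<open>
  The defect grows from \<open>0\<close> for isolated nodes to \<open>0\<close> for the whole plane graph.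
\<close>

lemma defect_zero:
  assumes S: "S \<subseteq> edges G"
  shows "defect S = 0"
proof -
  have "linked G {} = Id" by (simp add: linked_def)
  then have "nodes G // linked G {} = (\<lambda>v. {v}) ` nodes G" by (auto simp: quotient_def)
  then have "card (nodes G // linked G {}) = card (nodes G)" by (simp add: card_image)
  then have "defect {} = 0" by (simp add: defect_def loops_none)
  moreover have "defect (edges G) = 0"
    using euler by (simp add: defect_def loops_all linked_edges[symmetric])
  ultimately show ?thesis using defect_mono[of "{}" S] defect_mono[of S "edges G"] S by simp
qed

theorem card_loops_eq:
  "S \<subseteq> edges G \<Longrightarrow> card (loops D S) + card (nodes G) = 2 * card (nodes G // linked G S) + card S"
  using defect_zero[of S] by (simp add: defect_def)

text \<open>
  As the defect stays \<open>0\<close>, the number of curves does change with every edge.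
\<close>

sublocale bifurcating_diagram D
proof
  show "finite (crossings D)" "finite (circles D)"
    using finite_edges finite_nodes by (simp_all add: medial_simps isolated_nodes_def)
  fix S e assume S: "S \<subseteq> crossings D" and e: "e \<in> crossings D - S"
  then have *: "S \<subseteq> edges G" "e \<in> edges G - S" "insert e S \<subseteq> edges G" by (auto simp: medial_simps)
  show "(end0 D e, end2 D e) \<in> same_loop D S \<longleftrightarrow> (end0 D e, end2 D e) \<notin> same_loop D (insert e S)"
    using defect_step[OF *(1,2)] defect_zero[OF *(1)] defect_zero[OF *(3)]
    by (cases "(end0 D e, end2 D e) \<in> same_loop D S"; cases "(end0 D e, end2 D e) \<in> same_loop D (insert e S)")
      (auto split: if_splits)
qed

end


section \<open>The Potts amplitude and Khovanov homology\<close>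

text \<open>
  With \<open>q = u / sqrt Q\<close> the equation says \<open>q + 1/q = sqrt Q\<close>, so that the weight of a loop
  in the state sum is \<open>sqrt Q\<close>. This is what singles out the three parameter values.
\<close>

lemma potts_point_equation:
  assumes h: "hbar > 0"
    and Qt: "(Q, t) \<in> {(2, hbar * pi / 2), (3, 2 * hbar * pi / 3), (4, hbar * pi)}"
  defines "u \<equiv> 1 - exp (\<i> * complex_of_real (t / hbar))"
  shows "u \<noteq> 0" "u ^ 2 + of_nat Q = of_nat Q * u" "Q > (0::nat)"
proof -
  have u: "u = 1 - cis (t / hbar)" by (simp add: u_def cis_conv_exp)
  have sq: "sqrt 3 * sqrt 3 = (3::real)" by simp
  consider "Q = 2" "t / hbar = pi / 2" | "Q = 3" "t / hbar = 2 * pi / 3" | "Q = 4" "t / hbar = pi"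
    using Qt h by auto
  then have "u \<noteq> 0 \<and> u ^ 2 + of_nat Q = of_nat Q * u \<and> Q > 0"
  proof cases
    case 1
    then have "u = 1 - \<i>" unfolding u 1(2) by simp
    then show ?thesis using 1 by (simp add: complex_eq_iff power2_eq_square)
  next
    case 2
    then have ReIm: "Re u = 3 / 2" "Im u = - (sqrt 3 / 2)"
      unfolding u 2(2) by (simp_all add: sin_120 cos_120)
    show ?thesis using 2(1) sq by (simp add: complex_eq_iff power2_eq_square ReIm)
  next
    case 3
    then have "u = 2" unfolding u 3(2) by simp
    then show ?thesis using 3 by simp
  qed
  then show "u \<noteq> 0" "u ^ 2 + of_nat Q = of_nat Q * u" "Q > 0" by blast+
qed

theorem mainTheorem4:
  fixes G :: "('v, 'e) embedded_graph"
    and hbar t :: real and Q :: nat and q :: complex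
  assumes "plane_graph G"
    and "hbar > 0"
    and "(Q, t) \<in> {(2, hbar * pi / 2), (3, 2 * hbar * pi / 3), (4, hbar * pi)}"
    and "q = (1 - exp (\<i> * complex_of_real (t / hbar))) / complex_of_real (sqrt (real Q))"
  shows "potts_amplitude G hbar Q t =
    complex_of_real (real Q powr (real (card (nodes G)) / 2)) *
      Sum_any (\<lambda>j::int. q powi j * of_int (euler_char (medial_diagram G) j))"
proof -
  interpret plane_graph_medial G by unfold_locales (rule assms(1))
  define u where "u = 1 - exp (\<i> * complex_of_real (t / hbar))"
  define r where "r = complex_of_real (sqrt (real Q))"
  define N where "N = card (nodes G)"
  note u = potts_point_equation[OF assms(2,3), folded u_def]
  have q: "q = u / r" by (simp add: assms(4) u_def r_def)
  have r2: "r ^ 2 = of_nat Q" by (simp add: r_def flip: of_real_power)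
  have r0: "r \<noteq> 0" using u(3) by (simp add: r_def)
  have q0: "q \<noteq> 0" using u(1) r0 by (simp add: q)
  have qr: "q + inverse q = r"
  proof -
    have "u * u + r * r = r * r * u" using u(2) r2 by (simp add: power2_eq_square)
    then show ?thesis using u(1) r0 by (simp add: q field_simps)
  qed
  have powr: "complex_of_real (real Q powr (real N / 2)) = r ^ N"
  proof -
    have "real Q powr (real N / 2) = (real Q powr (1 / 2)) powr real N" by (simp add: powr_powr)
    also have "\<dots> = sqrt (real Q) ^ N" using u(3) by (simp add: powr_half_sqrt powr_realpow)
    finally show ?thesis by (simp add: r_def)
  qed
  have coefficient: "(- u) ^ card S * of_nat Q ^ card (nodes G // linked G S)
      = r ^ N * ((- q) ^ card S * r ^ card (loops D S))" if "S \<in> Pow (edges G)" for S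
  proof -
    let ?k = "card (nodes G // linked G S)"
    have "card (loops D S) + N = 2 * ?k + card S"
      using card_loops_eq that by (simp add: N_def)
    then have "r ^ (card (loops D S) + N) = r ^ (2 * ?k + card S)" by simp
    then have "r ^ N * r ^ card (loops D S) = (r ^ 2) ^ ?k * r ^ card S"
      by (simp only: power_add power_mult mult.commute)
    moreover have "(- u) ^ card S = (- q) ^ card S * r ^ card S"
      using r0 by (simp add: q flip: power_mult_distrib)
    ultimately show ?thesis unfolding r2 by (simp add: mult_ac)
  qed
  have "potts_amplitude G hbar Q t
      = (\<Sum>S\<in>Pow (edges G). (- u) ^ card S * of_nat Q ^ card (nodes G // linked G S))"
    using fortuin_kasteleyn[of G hbar Q t] finite_nodes finite_edges base_in by (simp add: u_def)
  also have "\<dots> = r ^ N * (\<Sum>S\<in>Pow (edges G). (- q) ^ card S * r ^ card (loops D S))"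
    unfolding sum_distrib_left by (intro sum.cong refl coefficient)
  also have "(\<Sum>S\<in>Pow (edges G). (- q) ^ card S * r ^ card (loops D S))
      = Sum_any (\<lambda>j::int. q powi j * of_int (euler_char D j))"
    using state_sum[OF q0] by (simp add: qr medial_simps)
  finally show ?thesis using powr by (simp add: N_def)
qed

end
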